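(* Let $S$ be a cancellative right LCM semigroup such that $\Phi_{\mathcal D}:C^*(S)\to\mathcal D$ is a faithful conditional expectation. Assume that whenever $s\in S$ and $F\subset S$ is finite with $sS\cap(S\setminus\bigcup_{q\in F}qS)\neq\emptyset$, there is $s'\in sS$ such that $s'S\cap qS=\emptyset$ for all $q\in F$. Assume further that one of the following conditions holds: (1) $|S^*|\le 1$; (2) $|S^*|>1$ and $S$ has the following property: whenever $s_0\in S$, $s_1\in s_0S$ and $F\subset S$ is finite with $s_1S\cap(S\setminus\bigcup_{q\in F}qS)\ne\emptyset$, then for every $x\in S^*\setminus\{1_S\}$ there is $s_2\in s_1S$ with $s_2S\cap(S\setminus\bigcup_{q\in F}qS)\neq\emptyset$ and $s_0^{-1}s_2S\cap x s_0^{-1}s_2S=\emptyset$, where $s_0^{-1}s_2S=\{y\in S: s_0y\in s_2S\}$; (3) $|S^*|>1$, for all $x\in S^*$ and $X\in\mathcal J(S)$ the condition $xX\cap X\neq\emptyset$ implies $xX=X$, and the action $S^*\curvearrowright\mathcal J(S)$ given by left multiplication is strongly effective. Then $C^*(S)$ is purely infinite and simple.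
   Context: Semigroups are discrete and non-empty and need not have an identity. If $S$ has an identity $1_S$, $S^*$ is its group of invertible elements; if $S$ has no identity we write $S^*=\emptyset$ (so $|S^*|=0$). Standing assumption: if $S^*=\emptyset$, then $aS=bS$ with $a,b\in S$ implies $a=b$. Here $pS=\{ps: s\in S\}$. $S$ is right LCM if it is left cancellative and for all $p,q\in S$ the set $pS\cap qS$ is either empty or equal to $rS$ for some $r\in S$. Cancellative means left and right cancellative. For a right ideal $X$ and $p\in S$ put $pX=\{px: x\in X\}$ and $p^{-1}X=\{y\in S: py\in X\}$. The family $\mathcal J(S)$ of constructible right ideals is the smallest family of right ideals (including the empty set) containing $\emptyset$ and $S$ and closed under $X\mapsto pX$ and $X\mapsto p^{-1}X$ for all $p\in S$. $C^*(S)$ is the universal unital $C^*$-algebra generated by isometries $(v_p)_{p\in S}$ and projections $(e_X)_{X\in\mathcal J(S)}$ satisfying, for all $p,q\in S$ and $X,Y\in\mathcal J(S)$: (L1) $v_pv_q=v_{pq}$; (L2) $v_pe_Xv_p^*=e_{pX}$; (L3) $e_\emptyset=0$ and $e_S=1$; (L4) $e_Xe_Y=e_{X\cap Y}$. $\mathcal D=C^*(\{e_X: X\in\mathcal J(S)\})\subseteq C^*(S)$. $\Phi_{\mathcal D}$ is the map determined by $\Phi_{\mathcal D}(v_pv_q^* )=v_pv_p^*$ if $p=q$ and $0$ if $p\ne q$, where $p,q$ range over $S$ if $S$ has an identity, and over the unitisation $\tilde S=S\cup\{1\}$ (with $v_1:=1$) if $S^*=\emptyset$; the hypothesis says that it extends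 to a conditional expectation $C^*(S)\to\mathcal D$ that is faithful on positive elements. (D1): for all $x\in S^*$ and $X\in\mathcal J(S)$, $xX\cap X\neq\emptyset$ implies $xX=X$. (D2): whenever $s_0\in S$, $s_1\in s_0S$ and $F\subset S$ is finite with $s_1S\cap(S\setminus\bigcup_{q\in F}qS)\ne\emptyset$, then for every $x\in S^*\setminus\{1_S\}$ there is $s_2\in s_1S$ with $s_2S\cap(S\setminus\bigcup_{q\in F}qS)\neq\emptyset$ and $s_0^{-1}s_2S\cap x s_0^{-1}s_2S=\emptyset$, where $s_0^{-1}s_2S=\{y\in S: s_0y\in s_2S\}$. (D3): whenever $s\in S$ and $F\subset S$ is finite with $sS\cap(S\setminus\bigcup_{q\in F}qS)\neq\emptyset$, there is $s'\in sS$ such that $s'S\cap qS=\emptyset$ for all $q\in F$. The action $S^*\curvearrowright\mathcal J(S)$, $x\cdot X=xX$, is strongly effective if for all $x\in S^*\setminus\{1_S\}$ and $p\in S$ there exists $q\in pS$ such that $xqS\neq qS$.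
   Formalization: Pure infiniteness is claimed only if S has at least two elements (for S={1}, C*(S) is the complex numbers); span{v_p v_q^*} (p,q in S, resp. its unitisation) is assumed dense in C*(S), which is automatic if S has an identity and otherwise needed for Φ_D to be determined by its values. *)

theory Defs
  imports Complex_Main
begin

section \<open>Semigroups\<close>

text \<open>A semigroup \<open>S\<close> is a type of class \<open>semigroup_mult\<close>; it may or may not have an identity.\<close>

definition is_identity :: "'s::semigroup_mult \<Rightarrow> bool" where
  "is_identity u \<longleftrightarrow> (\<forall>s. u * s = s \<and> s * u = s)"

definition invertibles :: "'s::semigroup_mult set" where
  "invertibles = {x. \<exists>u y. is_identity u \<and> x * y = u \<and> y * x = u}"

definition lmult :: "'s::semigroup_mult \<Rightarrow> 's set \<Rightarrow> 's set" where
  "lmult p X = {p * x | x. x \<in> X}"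

definition lpreimage :: "'s::semigroup_mult \<Rightarrow> 's set \<Rightarrow> 's set" where
  "lpreimage p X = {y. p * y \<in> X}"

definition principal_right :: "'s::semigroup_mult \<Rightarrow> 's set" where
  "principal_right p = lmult p UNIV"

definition left_cancellative :: "'s::semigroup_mult itself \<Rightarrow> bool" where
  "left_cancellative _ \<longleftrightarrow> (\<forall>a b c :: 's. c * a = c * b \<longrightarrow> a = b)"

definition right_cancellative :: "'s::semigroup_mult itself \<Rightarrow> bool" where
  "right_cancellative _ \<longleftrightarrow> (\<forall>a b c :: 's. a * c = b * c \<longrightarrow> a = b)"

definition right_LCM :: "'s::semigroup_mult itself \<Rightarrow> bool" where
  "right_LCM _ \<longleftrightarrow> left_cancellative TYPE('s) \<and>
     (\<forall>p q :: 's. principal_right p \<inter> principal_right q = {} \<or>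
        (\<exists>r. principal_right p \<inter> principal_right q = principal_right r))"

inductive_set constructible :: "'s::semigroup_mult set set" where
  empty: "{} \<in> constructible"
| whole: "UNIV \<in> constructible"
| lmult: "X \<in> constructible \<Longrightarrow> lmult p X \<in> constructible"
| lpreimage: "X \<in> constructible \<Longrightarrow> lpreimage p X \<in> constructible"

definition cond_D1 :: "'s::semigroup_mult itself \<Rightarrow> bool" where
  "cond_D1 _ \<longleftrightarrow> (\<forall>x \<in> invertibles :: 's set. \<forall>X \<in> constructible.
     lmult x X \<inter> X \<noteq> {} \<longrightarrow> lmult x X = X)"

definition cond_D2 :: "'s::semigroup_mult itself \<Rightarrow> bool" where
  "cond_D2 _ \<longleftrightarrow> (\<forall>(s0 :: 's) s1 F.
     s1 \<in> principal_right s0 \<and> finite F \<and> principal_right s1 \<inter> (UNIV - (\<Union>q\<in>F. principal_right q)) \<noteq> {} \<longrightarrow>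
     (\<forall>x \<in> invertibles. \<not> is_identity x \<longrightarrow>
       (\<exists>s2 \<in> principal_right s1.
          principal_right s2 \<inter> (UNIV - (\<Union>q\<in>F. principal_right q)) \<noteq> {} \<and>
          lpreimage s0 (principal_right s2) \<inter> lmult x (lpreimage s0 (principal_right s2)) = {})))"

definition cond_D3 :: "'s::semigroup_mult itself \<Rightarrow> bool" where
  "cond_D3 _ \<longleftrightarrow> (\<forall>(s :: 's) F.
     finite F \<and> principal_right s \<inter> (UNIV - (\<Union>q\<in>F. principal_right q)) \<noteq> {} \<longrightarrow>
     (\<exists>s' \<in> principal_right s. \<forall>q\<in>F. principal_right s' \<inter> principal_right q = {}))"

definition strongly_effective :: "'s::semigroup_mult itself \<Rightarrow> bool" where
  "strongly_effective _ \<longleftrightarrow> (\<forall>x \<in> invertibles :: 's set. \<not> is_identity x \<longrightarrow>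
     (\<forall>p. \<exists>q \<in> principal_right p. lmult x (principal_right q) \<noteq> principal_right q))"


section \<open>C*-algebras\<close>

text \<open>Nonzero unital C*-algebras. The norm is submultiplicative, complete and satisfies
  \<open>norm 1 = 1\<close> by the parent classes.\<close>

class unital_cstar = real_normed_algebra_1 + banach +
  fixes scaleC :: "complex \<Rightarrow> 'a \<Rightarrow> 'a"  (infixr "*\<^sub>C" 75)
    and star :: "'a \<Rightarrow> 'a"
  assumes scaleC_of_real: "complex_of_real r *\<^sub>C a = r *\<^sub>R a"
    and scaleC_add_right: "z *\<^sub>C (a + b) = z *\<^sub>C a + z *\<^sub>C b"
    and scaleC_add_left: "(z + w) *\<^sub>C a = z *\<^sub>C a + w *\<^sub>C a"
    and scaleC_scaleC: "z *\<^sub>C (w *\<^sub>C a) = (z * w) *\<^sub>C a"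
    and scaleC_mult_left: "(z *\<^sub>C a) * b = z *\<^sub>C (a * b)"
    and scaleC_mult_right: "a * (z *\<^sub>C b) = z *\<^sub>C (a * b)"
    and norm_scaleC: "norm (z *\<^sub>C a) = cmod z * norm a"
    and star_star: "star (star a) = a"
    and star_add: "star (a + b) = star a + star b"
    and star_scaleC: "star (z *\<^sub>C a) = cnj z *\<^sub>C star a"
    and star_mult: "star (a * b) = star b * star a"
    and cstar_identity: "norm (star a * a) = (norm a)\<^sup>2"

definition csubspace :: "'a::unital_cstar set \<Rightarrow> bool" where
  "csubspace V \<longleftrightarrow> 0 \<in> V \<and> (\<forall>a\<in>V. \<forall>b\<in>V. a + b \<in> V) \<and> (\<forall>z. \<forall>a\<in>V. z *\<^sub>C a \<in> V)"

definition closed_cspan :: "'a::unital_cstar set \<Rightarrow> 'a set" where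
  "closed_cspan X = \<Inter>{V. csubspace V \<and> closed V \<and> X \<subseteq> V}"

definition cstar_subalgebra :: "'a::unital_cstar set \<Rightarrow> bool" where
  "cstar_subalgebra B \<longleftrightarrow> csubspace B \<and> closed B \<and>
     (\<forall>a\<in>B. \<forall>b\<in>B. a * b \<in> B) \<and> (\<forall>a\<in>B. star a \<in> B)"

definition cstar_generated :: "'a::unital_cstar set \<Rightarrow> 'a set" where
  "cstar_generated X = \<Inter>{B. cstar_subalgebra B \<and> X \<subseteq> B}"

definition cpositive :: "'a::unital_cstar \<Rightarrow> bool" where
  "cpositive a \<longleftrightarrow> (\<exists>b. a = star b * b)"

definition cle :: "'a::unital_cstar \<Rightarrow> 'a \<Rightarrow> bool" where
  "cle a b \<longleftrightarrow> cpositive (b - a)"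

definition is_projection :: "'a::unital_cstar \<Rightarrow> bool" where
  "is_projection p \<longleftrightarrow> star p = p \<and> p * p = p"

text \<open>A projection is infinite if it is Murray-von Neumann equivalent to a proper
  subprojection of itself.\<close>

definition infinite_projection :: "'a::unital_cstar \<Rightarrow> bool" where
  "infinite_projection p \<longleftrightarrow> is_projection p \<and>
     (\<exists>q u. is_projection q \<and> cle q p \<and> q \<noteq> p \<and> star u * u = p \<and> u * star u = q)"

definition hereditary_subalgebra :: "'a::unital_cstar set \<Rightarrow> bool" where
  "hereditary_subalgebra B \<longleftrightarrow> cstar_subalgebra B \<and>
     (\<forall>a b. cpositive a \<and> cle a b \<and> b \<in> B \<longrightarrow> a \<in> B)"

definition simple_cstar :: "'a::unital_cstar itself \<Rightarrow> bool" where
  "simple_cstar _ \<longleftrightarrow> (\<forall>I :: 'a set.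
     csubspace I \<and> closed I \<and> (\<forall>a. \<forall>x\<in>I. a * x \<in> I \<and> x * a \<in> I) \<longrightarrow> I = {0} \<or> I = UNIV)"

text \<open>Pure infiniteness in the sense of Cuntz, for simple C*-algebras. The complex numbers are
  simple but not purely infinite in this sense; they are \<open>C\<^sup>*(S)\<close> for the one-element
  semigroup \<open>S\<close>.\<close>

definition purely_infinite :: "'a::unital_cstar itself \<Rightarrow> bool" where
  "purely_infinite _ \<longleftrightarrow> (\<forall>B :: 'a set.
     hereditary_subalgebra B \<and> B \<noteq> {0} \<longrightarrow> (\<exists>p\<in>B. infinite_projection p))"

definition conditional_expectation :: "'a::unital_cstar set \<Rightarrow> ('a \<Rightarrow> 'a) \<Rightarrow> bool" where
  "conditional_expectation D E \<longleftrightarrow>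
     (\<forall>a b. E (a + b) = E a + E b) \<and> (\<forall>z a. E (z *\<^sub>C a) = z *\<^sub>C E a) \<and>
     range E \<subseteq> D \<and> (\<forall>d\<in>D. E d = d) \<and>
     (\<forall>a. norm (E a) \<le> norm a) \<and>
     (\<forall>a. cpositive a \<longrightarrow> cpositive (E a)) \<and>
     (\<forall>a. \<forall>d\<in>D. \<forall>d'\<in>D. E (d * a * d') = d * E a * d')"

definition faithful_on_positives :: "('a::unital_cstar \<Rightarrow> 'a) \<Rightarrow> bool" where
  "faithful_on_positives E \<longleftrightarrow> (\<forall>a. cpositive a \<and> E a = 0 \<longrightarrow> a = 0)"


section \<open>C*-algebras on a carrier set\<close>

text \<open>HOL cannot quantify over types inside a formula, so the target algebras of the
  universal property are C*-algebra structures on subsets of a fixed type.\<close>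

record 'b cstar_struct =
  cs_carrier :: "'b set"
  cs_zero :: 'b
  cs_one :: 'b
  cs_add :: "'b \<Rightarrow> 'b \<Rightarrow> 'b"
  cs_mult :: "'b \<Rightarrow> 'b \<Rightarrow> 'b"
  cs_scale :: "complex \<Rightarrow> 'b \<Rightarrow> 'b"
  cs_star :: "'b \<Rightarrow> 'b"
  cs_norm :: "'b \<Rightarrow> real"

definition cs_dist :: "'b cstar_struct \<Rightarrow> 'b \<Rightarrow> 'b \<Rightarrow> real" where
  "cs_dist B a b = cs_norm B (cs_add B a (cs_scale B (-1) b))"

locale cstar_on =
  fixes B :: "'b cstar_struct" (structure)
  assumes zero_closed: "cs_zero B \<in> cs_carrier B"
    and one_closed: "cs_one B \<in> cs_carrier B"
    and add_closed: "\<lbrakk>a \<in> cs_carrier B; b \<in> cs_carrier B\<rbrakk> \<Longrightarrow> cs_add B a b \<in> cs_carrier B"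
    and mult_closed: "\<lbrakk>a \<in> cs_carrier B; b \<in> cs_carrier B\<rbrakk> \<Longrightarrow> cs_mult B a b \<in> cs_carrier B"
    and scale_closed: "a \<in> cs_carrier B \<Longrightarrow> cs_scale B z a \<in> cs_carrier B"
    and star_closed: "a \<in> cs_carrier B \<Longrightarrow> cs_star B a \<in> cs_carrier B"
    and add_assoc: "\<lbrakk>a \<in> cs_carrier B; b \<in> cs_carrier B; c \<in> cs_carrier B\<rbrakk> \<Longrightarrow>
      cs_add B (cs_add B a b) c = cs_add B a (cs_add B b c)"
    and add_commute: "\<lbrakk>a \<in> cs_carrier B; b \<in> cs_carrier B\<rbrakk> \<Longrightarrow> cs_add B a b = cs_add B b a"
    and add_zero: "a \<in> cs_carrier B \<Longrightarrow> cs_add B (cs_zero B) a = a"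
    and add_inverse: "a \<in> cs_carrier B \<Longrightarrow> cs_add B a (cs_scale B (-1) a) = cs_zero B"
    and scale_one: "a \<in> cs_carrier B \<Longrightarrow> cs_scale B 1 a = a"
    and scale_scale: "a \<in> cs_carrier B \<Longrightarrow>
      cs_scale B z (cs_scale B w a) = cs_scale B (z * w) a"
    and scale_add_left: "a \<in> cs_carrier B \<Longrightarrow>
      cs_scale B (z + w) a = cs_add B (cs_scale B z a) (cs_scale B w a)"
    and scale_add_right: "\<lbrakk>a \<in> cs_carrier B; b \<in> cs_carrier B\<rbrakk> \<Longrightarrow>
      cs_scale B z (cs_add B a b) = cs_add B (cs_scale B z a) (cs_scale B z b)"
    and mult_assoc: "\<lbrakk>a \<in> cs_carrier B; b \<in> cs_carrier B; c \<in> cs_carrier B\<rbrakk> \<Longrightarrow>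
      cs_mult B (cs_mult B a b) c = cs_mult B a (cs_mult B b c)"
    and one_mult: "a \<in> cs_carrier B \<Longrightarrow> cs_mult B (cs_one B) a = a"
    and mult_one: "a \<in> cs_carrier B \<Longrightarrow> cs_mult B a (cs_one B) = a"
    and distrib_left: "\<lbrakk>a \<in> cs_carrier B; b \<in> cs_carrier B; c \<in> cs_carrier B\<rbrakk> \<Longrightarrow>
      cs_mult B a (cs_add B b c) = cs_add B (cs_mult B a b) (cs_mult B a c)"
    and distrib_right: "\<lbrakk>a \<in> cs_carrier B; b \<in> cs_carrier B; c \<in> cs_carrier B\<rbrakk> \<Longrightarrow>
      cs_mult B (cs_add B a b) c = cs_add B (cs_mult B a c) (cs_mult B b c)"
    and scale_mult_left: "\<lbrakk>a \<in> cs_carrier B; b \<in> cs_carrier B\<rbrakk> \<Longrightarrow>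
      cs_mult B (cs_scale B z a) b = cs_scale B z (cs_mult B a b)"
    and scale_mult_right: "\<lbrakk>a \<in> cs_carrier B; b \<in> cs_carrier B\<rbrakk> \<Longrightarrow>
      cs_mult B a (cs_scale B z b) = cs_scale B z (cs_mult B a b)"
    and star_star: "a \<in> cs_carrier B \<Longrightarrow> cs_star B (cs_star B a) = a"
    and star_add: "\<lbrakk>a \<in> cs_carrier B; b \<in> cs_carrier B\<rbrakk> \<Longrightarrow>
      cs_star B (cs_add B a b) = cs_add B (cs_star B a) (cs_star B b)"
    and star_scale: "a \<in> cs_carrier B \<Longrightarrow>
      cs_star B (cs_scale B z a) = cs_scale B (cnj z) (cs_star B a)"
    and star_mult: "\<lbrakk>a \<in> cs_carrier B; b \<in> cs_carrier B\<rbrakk> \<Longrightarrow>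
      cs_star B (cs_mult B a b) = cs_mult B (cs_star B b) (cs_star B a)"
    and norm_nonneg: "a \<in> cs_carrier B \<Longrightarrow> 0 \<le> cs_norm B a"
    and norm_eq_zero: "a \<in> cs_carrier B \<Longrightarrow> cs_norm B a = 0 \<longleftrightarrow> a = cs_zero B"
    and norm_triangle: "\<lbrakk>a \<in> cs_carrier B; b \<in> cs_carrier B\<rbrakk> \<Longrightarrow>
      cs_norm B (cs_add B a b) \<le> cs_norm B a + cs_norm B b"
    and norm_scale: "a \<in> cs_carrier B \<Longrightarrow> cs_norm B (cs_scale B z a) = cmod z * cs_norm B a"
    and norm_mult: "\<lbrakk>a \<in> cs_carrier B; b \<in> cs_carrier B\<rbrakk> \<Longrightarrow>
      cs_norm B (cs_mult B a b) \<le> cs_norm B a * cs_norm B b"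
    and cstar_identity: "a \<in> cs_carrier B \<Longrightarrow>
      cs_norm B (cs_mult B (cs_star B a) a) = (cs_norm B a)\<^sup>2"
    and complete: "\<lbrakk>\<And>n :: nat. X n \<in> cs_carrier B;
        \<And>\<epsilon>. \<epsilon> > 0 \<Longrightarrow> \<exists>N. \<forall>m\<ge>N. \<forall>n\<ge>N. cs_dist B (X m) (X n) < \<epsilon>\<rbrakk> \<Longrightarrow>
      \<exists>l \<in> cs_carrier B. (\<lambda>n. cs_dist B (X n) l) \<longlonglongrightarrow> 0"

definition unital_star_hom :: "'a cstar_struct \<Rightarrow> 'b cstar_struct \<Rightarrow> ('a \<Rightarrow> 'b) \<Rightarrow> bool" where
  "unital_star_hom A B h \<longleftrightarrow>
     (\<forall>a \<in> cs_carrier A. h a \<in> cs_carrier B) \<and>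
     h (cs_one A) = cs_one B \<and>
     (\<forall>a \<in> cs_carrier A. \<forall>b \<in> cs_carrier A. h (cs_add A a b) = cs_add B (h a) (h b)) \<and>
     (\<forall>a \<in> cs_carrier A. \<forall>b \<in> cs_carrier A. h (cs_mult A a b) = cs_mult B (h a) (h b)) \<and>
     (\<forall>z. \<forall>a \<in> cs_carrier A. h (cs_scale A z a) = cs_scale B z (h a)) \<and>
     (\<forall>a \<in> cs_carrier A. h (cs_star A a) = cs_star B (h a))"

definition cs_UNIV :: "'a::unital_cstar cstar_struct" where
  "cs_UNIV = \<lparr>cs_carrier = UNIV, cs_zero = 0, cs_one = 1, cs_add = (+), cs_mult = (*),
     cs_scale = scaleC, cs_star = star, cs_norm = norm\<rparr>"

lemma cstar_on_cs_UNIV: "cstar_on (cs_UNIV :: 'a::unital_cstar cstar_struct)"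
proof -
  have minus: "(-1) *\<^sub>C a = - a" for a :: 'a
    using scaleC_of_real[of "-1" a] by simp
  have one: "1 *\<^sub>C a = a" for a :: 'a
    using scaleC_of_real[of 1 a] by simp
  have complete: "\<exists>l. (\<lambda>n. norm (X n - l)) \<longlonglongrightarrow> 0"
    if "\<And>\<epsilon>. \<epsilon> > 0 \<Longrightarrow> \<exists>N. \<forall>m\<ge>N. \<forall>n\<ge>N. norm (X m - X n) < \<epsilon>" for X :: "nat \<Rightarrow> 'a"
  proof -
    have "Cauchy X"
      using that by (simp add: Cauchy_def dist_norm)
    then obtain l where "X \<longlonglongrightarrow> l"
      using Cauchy_convergent convergent_def by blast
    then show ?thesis
      using tendsto_norm_zero LIM_zero by blast
  qed
  show ?thesis
    by unfold_locales
      (auto simp: cs_UNIV_def cs_dist_def minus one add_ac mult.assoc algebra_simps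
        scaleC_add_right scaleC_add_left scaleC_scaleC scaleC_mult_left scaleC_mult_right
        norm_scaleC star_star star_add star_scaleC star_mult cstar_identity
        norm_triangle_ineq norm_mult_ineq complete)
qed


section \<open>The semigroup C*-algebra\<close>

text \<open>Isometries \<open>v p\<close> and projections \<open>e X\<close> (\<open>X\<close> constructible) subject to (L1)-(L4).
  Only the values of \<open>e\<close> on constructible right ideals matter.\<close>

definition semigroup_relations ::
    "'b cstar_struct \<Rightarrow> ('s::semigroup_mult \<Rightarrow> 'b) \<Rightarrow> ('s set \<Rightarrow> 'b) \<Rightarrow> bool" where
  "semigroup_relations B v e \<longleftrightarrow>
     (\<forall>p. v p \<in> cs_carrier B \<and> cs_mult B (cs_star B (v p)) (v p) = cs_one B) \<and>
     (\<forall>X \<in> constructible.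
        e X \<in> cs_carrier B \<and> cs_star B (e X) = e X \<and> cs_mult B (e X) (e X) = e X) \<and>
     (\<forall>p q. cs_mult B (v p) (v q) = v (p * q)) \<and>
     (\<forall>p. \<forall>X \<in> constructible.
        cs_mult B (cs_mult B (v p) (e X)) (cs_star B (v p)) = e (lmult p X)) \<and>
     e {} = cs_zero B \<and> e UNIV = cs_one B \<and>
     (\<forall>X \<in> constructible. \<forall>Y \<in> constructible. cs_mult B (e X) (e Y) = e (X \<inter> Y))"

text \<open>The type \<open>'a\<close> with the families \<open>v\<close>, \<open>e\<close> is \<open>C\<^sup>*(S)\<close>: it is generated by them (which makes
  the homomorphisms below unique) and has the universal property.
  The carrier type \<open>'s list \<Rightarrow> complex\<close> of the targets is no restriction. The constructible
  right ideals are indexed by finite words over \<open>S\<close>, so with \<open>\<kappa>\<close> the maximum of \<open>|S|\<close> and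
  \<open>\<aleph>\<^sub>0\<close> a C*-algebra generated by such families has a dense subset of
  size at most \<open>\<kappa>\<close>, hence at most \<open>\<kappa>\<close> to the power \<open>\<aleph>\<^sub>0\<close> elements, whereas
  \<open>'s list \<Rightarrow> complex\<close> has \<open>2\<close> to the power \<open>\<kappa>\<close>; so it contains a copy of every such algebra.\<close>

definition semigroup_cstar ::
    "('s::semigroup_mult \<Rightarrow> 'a::unital_cstar) \<Rightarrow> ('s set \<Rightarrow> 'a) \<Rightarrow> bool" where
  "semigroup_cstar v e \<longleftrightarrow>
     semigroup_relations cs_UNIV v e \<and>
     cstar_generated (range v \<union> e ` constructible) = UNIV \<and>
     (\<forall>(B :: ('s list \<Rightarrow> complex) cstar_struct) w f.
        cstar_on B \<and> semigroup_relations B w f \<longrightarrow>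
        (\<exists>h. unital_star_hom cs_UNIV B h \<and>
             (\<forall>p. h (v p) = w p) \<and> (\<forall>X \<in> constructible. h (e X) = f X)))"

definition diagonal :: "('s::semigroup_mult set \<Rightarrow> 'a::unital_cstar) \<Rightarrow> 'a set" where
  "diagonal e = cstar_generated (e ` constructible)"

text \<open>The unitisation of \<open>S\<close>, used only if \<open>S\<close> has no identity: \<open>None\<close> is the adjoined identity.\<close>

definition unitisation :: "'s::semigroup_mult option set" where
  "unitisation = (if \<exists>u :: 's. is_identity u then range Some else UNIV)"

definition unitise :: "('s \<Rightarrow> 'a::unital_cstar) \<Rightarrow> 's option \<Rightarrow> 'a" where
  "unitise v p = (case p of None \<Rightarrow> 1 | Some s \<Rightarrow> v s)"

text \<open>The map \<open>\<Phi>\<close> sending \<open>v p * star (v q)\<close> to \<open>v p * star (v p)\<close> if \<open>p = q\<close> and to \<open>0\<close> otherwise is a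
  faithful conditional expectation onto the diagonal. The first conjunct expresses that a bounded
  linear map is determined by these values; for right LCM semigroups with an identity it always
  holds, since there \<open>v p\<^sup>* v q\<close> is \<open>0\<close> or \<open>v x v y\<^sup>*\<close> when \<open>pS \<inter> qS = rS\<close> and \<open>r = px = qy\<close>.
  Without an identity \<open>r\<close> may fail to lie in \<open>pS\<close> or \<open>qS\<close>.\<close>

definition Phi_D_faithful_expectation ::
    "('s::semigroup_mult \<Rightarrow> 'a::unital_cstar) \<Rightarrow> ('s set \<Rightarrow> 'a) \<Rightarrow> bool" where
  "Phi_D_faithful_expectation v e \<longleftrightarrow>
     closed_cspan {unitise v p * star (unitise v q) | p q. p \<in> unitisation \<and> q \<in> unitisation} = UNIV \<and>
     (\<exists>\<Phi>. conditional_expectation (diagonal e) \<Phi> \<and> faithful_on_positives \<Phi> \<and>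
        (\<forall>p \<in> unitisation. \<forall>q \<in> unitisation.
           \<Phi> (unitise v p * star (unitise v q)) =
             (if p = q then unitise v p * star (unitise v p) else 0)))"

end

theory Submission
  imports Defs "HOL-Analysis.Analysis"
begin

text \<open>Given \<open>b \<noteq> 0\<close>, approximate \<open>b\<^sup>* b\<close> by a finite sum \<open>x\<close> of terms \<open>l v\<^sub>p v\<^sub>q\<^sup>*\<close>. The norm of
  \<open>\<Phi>(x)\<close> is attained on a nonzero projection \<open>e\<^sub>r\<^sub>S \<Prod> (1 - e\<^sub>q\<^sub>S)\<close>. Independence of the constructible
  ideals and (D3) put some \<open>e\<^sub>s\<^sub>S\<close> below it, and shrinking \<open>s\<close> kills the off-diagonal terms, because
  distinct \<open>t, t'\<close> always have \<open>z\<close> with \<open>t z S \<inter> t' z S = {}\<close>. So \<open>v\<^sub>s\<^sup>* b\<^sup>* b v\<^sub>s\<close> is close to a nonzero scalar,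
  hence invertible. This gives simplicity, and after normalising an isometry \<open>b y\<close> whose range
  projection lies in any hereditary subalgebra containing \<open>b\<close>.

  If \<open>S\<close> has no identity, independence is not automatic. It comes from the hypothesis that the
  \<open>v\<^sub>p v\<^sub>q\<^sup>*\<close> span a dense subspace.\<close>

section \<open>C*-algebras\<close>

lemma scaleC_one [simp]: "1 *\<^sub>C (a::'a::unital_cstar) = a"
  using scaleC_of_real[of 1 a] by simp

lemma scaleC_zero_left [simp]: "0 *\<^sub>C (a::'a::unital_cstar) = 0"
  using scaleC_of_real[of 0 a] by simp

lemma scaleC_zero_right [simp]: "z *\<^sub>C (0::'a::unital_cstar) = 0"
  using scaleC_add_right[of z 0 "0::'a"] by simp

lemma scaleC_minus_left: "(- z) *\<^sub>C (a::'a::unital_cstar) = - (z *\<^sub>C a)"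
  using scaleC_add_left[of z "-z" a] by (simp add: eq_neg_iff_add_eq_0 add.commute)

lemma scaleC_diff_right: "z *\<^sub>C (a - b::'a::unital_cstar) = z *\<^sub>C a - z *\<^sub>C b"
  using scaleC_add_right[of z "a - b" b] by (simp add: algebra_simps)

lemma star_scaleR: "star (r *\<^sub>R a) = r *\<^sub>R star (a::'a::unital_cstar)"
  using star_scaleC[of "complex_of_real r" a] by (simp add: scaleC_of_real)

lemma star_zero [simp]: "star (0::'a::unital_cstar) = 0"
  using star_add[of 0 "0::'a"] by simp

lemma star_diff: "star (a - b) = star a - star (b::'a::unital_cstar)"
  using star_add[of "a - b" b] by (simp add: algebra_simps)

lemma star_one [simp]: "star (1::'a::unital_cstar) = 1"
  by (metis mult.right_neutral star_mult star_star mult_1)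

lemma star_power: "star (a ^ n) = star (a::'a::unital_cstar) ^ n"
  by (induction n) (auto simp: star_mult power_commutes)

lemma norm_star [simp]: "norm (star a) = norm (a::'a::unital_cstar)"
proof -
  have le: "norm b \<le> norm (star b)" for b :: 'a
  proof (cases "b = 0")
    case True
    then show ?thesis by simp
  next
    case False
    have "norm b * norm b \<le> norm (star b) * norm b"
      using cstar_identity[of b] norm_mult_ineq[of "star b" b] by (simp add: power2_eq_square)
    then show ?thesis using False by simp
  qed
  show ?thesis
    using le[of a] le[of "star a"] by (simp add: star_star)
qed

lemma star_mult_self_eq_0: "star a * a = 0 \<longleftrightarrow> (a::'a::unital_cstar) = 0"
  using cstar_identity[of a] by auto

lemma norm_isometry:
  assumes "star (a::'a::unital_cstar) * a = 1"
  shows "norm a = 1"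
  using cstar_identity[of a] assms by (simp add: power2_eq_1_iff)
     (smt (verit) norm_ge_zero)

lemma tendsto_star: "(X \<longlongrightarrow> l) F \<Longrightarrow> ((\<lambda>n. star (X n)) \<longlongrightarrow> star (l::'a::unital_cstar)) F"
  by (simp add: tendsto_iff dist_norm flip: star_diff)

lemma continuous_on_star: "continuous_on S f \<Longrightarrow> continuous_on S (\<lambda>x. star (f x::'a::unital_cstar))"
  by (simp add: continuous_on_def tendsto_star)

section \<open>Norms of self-adjoint elements and of compressions by commuting projections\<close>

lemma norm_self_adjoint_power:
  fixes h :: "'a::unital_cstar"
  assumes "star h = h"
  shows "norm (h ^ (2 ^ k)) = norm h ^ (2 ^ k)"
proof (induction k)
  case (Suc k)
  have "norm (h ^ (2 ^ Suc k)) = norm (star (h ^ 2 ^ k) * (h ^ 2 ^ k))"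
    by (simp add: star_power assms flip: power_add mult_2)
  also have "\<dots> = norm h ^ (2 ^ Suc k)"
    by (simp only: cstar_identity Suc) (simp flip: power_mult add: mult.commute)
  finally show ?case .
qed simp

lemma is_projection_compl: "is_projection e \<Longrightarrow> is_projection (1 - e::'a::unital_cstar)"
  by (simp add: is_projection_def star_diff algebra_simps)

lemma norm_projection_le:
  assumes "is_projection (e::'a::unital_cstar)"
  shows "norm e \<le> 1"
proof (cases "e = 0")
  case False
  have "norm e * norm e = norm e"
    using cstar_identity[of e] assms by (simp add: is_projection_def power2_eq_square)
  then show ?thesis using False by simp
qed simp

lemma commuting_idempotent_power:
  fixes e :: "'a::monoid_mult"
  assumes "e * h = h * e" "e * e = e"
  shows "e * h ^ Suc n = (e * h) ^ Suc n"
proof (induction n)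
  case (Suc n)
  have "e * h ^ Suc (Suc n) = (e * e) * h * h ^ Suc n"
    by (simp only: assms(2) power_Suc mult.assoc)
  also have "\<dots> = (e * h) * (e * h ^ Suc n)"
    using assms(1) by (metis mult.assoc)
  finally show ?case unfolding Suc by simp
qed simp

text \<open>The power \<open>h ^ (2 ^ k)\<close> splits into the same powers of \<open>e * h\<close>
  and \<open>(1 - e) * h\<close>. Its norm is exactly \<open>norm h ^ (2 ^ k)\<close>, so the factor
  2 from the triangle inequality becomes negligible as \<open>k\<close> grows.\<close>

lemma norm_le_max_compression_aux:
  fixes e h :: "'a::unital_cstar"
  assumes e: "is_projection e" and comm: "e * h = h * e" and h: "star h = h"
    and 1: "norm (e * h) \<le> M" and 2: "norm ((1 - e) * h) \<le> M"
  shows "norm h \<le> M"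
proof (rule ccontr)
  assume "\<not> norm h \<le> M"
  then have lt: "M < norm h" by simp
  have M: "0 \<le> M" using 1 norm_ge_zero order_trans by blast
  have bound: "norm h ^ (2 ^ k) \<le> 2 * M ^ (2 ^ k)" for k
  proof -
    \<comment> \<open>The identity between \<open>e * h ^ n\<close> and \<open>(e * h) ^ n\<close>
      can fail at exponent 0, so the exponent is exhibited as a successor.\<close>
    obtain n where n: "2 ^ k = Suc n" by (metis not0_implies_Suc power_not_zero zero_neq_numeral)
    have "h ^ (2 ^ k) = e * h ^ (2 ^ k) + (1 - e) * h ^ (2 ^ k)"
      by (simp add: algebra_simps)
    also have "\<dots> = (e * h) ^ (2 ^ k) + ((1 - e) * h) ^ (2 ^ k)"
      unfolding n
      by (subst (1 2) commuting_idempotent_power)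
        (use e comm in \<open>auto simp: is_projection_def algebra_simps\<close>)
    finally have "norm h ^ (2 ^ k) \<le> norm ((e * h) ^ (2 ^ k)) + norm (((1 - e) * h) ^ (2 ^ k))"
      by (metis h norm_self_adjoint_power norm_triangle_ineq)
    also have "\<dots> \<le> M ^ (2 ^ k) + M ^ (2 ^ k)"
      by (intro add_mono order_trans[OF norm_power_ineq] power_mono 1 2) auto
    finally show ?thesis by simp
  qed
  show False
  proof (cases "M = 0")
    case True
    then show False using bound[of 0] lt by simp
  next
    case False
    then have "1 < norm h / M" using lt M by simp
    then obtain n where n: "2 < (norm h / M) ^ n"
      using real_arch_pow by blast
    have "(norm h / M) ^ n \<le> (norm h / M) ^ (2 ^ n)"
      using \<open>1 < norm h / M\<close> by (intro power_increasing) (auto intro: less_imp_le)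
    also have "\<dots> \<le> 2"
      using bound[of n] False M by (simp add: power_divide field_simps)
    finally show False using n by simp
  qed
qed

text \<open>The self-adjoint case is applied to \<open>star y * y\<close>; by the C*-identity all
  norms involved are squares.\<close>

lemma norm_le_max_compression:
  fixes e y :: "'a::unital_cstar"
  assumes e: "is_projection e" and comm: "e * y = y * e"
  shows "norm y \<le> max (norm (e * y)) (norm ((1 - e) * y))"
proof -
  define M where "M = max (norm (e * y)) (norm ((1 - e) * y))"
  have comm': "e * star y = star y * e"
    using e comm by (metis is_projection_def star_mult)
  have bd: "norm (f * (star y * y)) = (norm (f * y))\<^sup>2"
    if "is_projection f" "f * star y = star y * f" for f
  proof -
    have "star (f * y) * (f * y) = star y * (f * f) * y"
      using that(1) by (metis is_projection_def star_mult mult.assoc)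
    also have "\<dots> = f * (star y * y)"
      using that by (metis is_projection_def mult.assoc)
    finally show ?thesis by (metis cstar_identity)
  qed
  have "norm (star y * y) \<le> M\<^sup>2"
  proof (rule norm_le_max_compression_aux[OF e])
    show "e * (star y * y) = star y * y * e"
      using comm comm' by (metis mult.assoc)
    show "star (star y * y) = star y * y" by (simp add: star_mult star_star)
    show "norm (e * (star y * y)) \<le> M\<^sup>2"
      by (subst bd) (auto simp: e comm' M_def intro!: power_mono)
    show "norm ((1 - e) * (star y * y)) \<le> M\<^sup>2"
      by (subst bd) (auto simp: is_projection_compl[OF e] comm' M_def algebra_simps intro!: power_mono)
  qed
  then have "(norm y)\<^sup>2 \<le> M\<^sup>2" by (simp add: cstar_identity)
  moreover have "0 \<le> M" by (simp add: M_def le_max_iff_disj)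
  ultimately show ?thesis by (auto simp: M_def dest: power2_le_imp_le)
qed

section \<open>Square roots and inverses near the identity by contraction\<close>

lemma self_adjoint_sqrt:
  fixes h :: "'a::unital_cstar"
  assumes h: "star h = h" and le: "norm h \<le> 3/4" and g: "g * h = h * g"
  obtains y where "star y = y" "norm y \<le> 1/2" "y * g = g * y" "(1 - y) * (1 - y) = 1 - h"
proof -
  define T where "T = {y::'a. star y = y \<and> norm y \<le> 1/2 \<and> y * g = g * y}"
  \<comment> \<open>The equation \<open>(1 - y) * (1 - y) = 1 - h\<close> is equivalent to
    \<open>f y = y\<close>. The bound 3/4 makes \<open>f\<close> preserve the ball of radius 1/2, as
    half of 3/4 + 1/4 is 1/2, and \<open>f\<close> at least halves distances there. The set
    \<open>T\<close> also records self-adjointness and commutation with \<open>g\<close>, so the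
    fixed point inherits both.\<close>
  define f where "f y = (1/2) *\<^sub>R (h + y * y)" for y :: 'a
  have "\<exists>!y\<in>T. f y = y"
  proof (rule Banach_fix[of _ "1/2"])
    have "closed T"
      unfolding T_def
      by (intro closed_Collect_conj closed_Collect_eq closed_Collect_le continuous_intros
          continuous_on_star)
    then show "complete T" by (simp add: complete_eq_closed)
    show "T \<noteq> {}" by (auto simp: T_def intro!: exI[of _ 0])
    show "f ` T \<subseteq> T"
    proof clarify
      fix y assume "y \<in> T"
      then have y: "star y = y" "norm y \<le> 1/2" "y * g = g * y" by (auto simp: T_def)
      have "norm (h + y * y) \<le> norm h + norm y * norm y"
        using norm_triangle_ineq norm_mult_ineq by (metis add_left_mono order_trans)
      also have "\<dots> \<le> 3/4 + (1/2) * (1/2)"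
        by (intro add_mono le mult_mono y) auto
      finally have "norm (f y) \<le> 1/2" by (simp add: f_def)
      moreover have "f y * g = g * f y"
        using y(3) g unfolding f_def
        by (simp add: algebra_simps) (metis mult.assoc)
      ultimately show "f y \<in> T"
        using y by (simp add: T_def f_def star_scaleR star_add star_mult h)
    qed
    show "dist (f x) (f y) \<le> (1/2) * dist x y" if "x \<in> T" "y \<in> T" for x y
    proof -
      from that
      have x: "norm x \<le> 1/2" and y: "norm y \<le> 1/2" by (auto simp: T_def)
      have "f x - f y = (1/2) *\<^sub>R (x * (x - y) + (x - y) * y)"
        by (simp add: f_def algebra_simps flip: scaleR_right_diff_distrib)
      moreover have "norm (x * (x - y) + (x - y) * y) \<le> (1/2) * norm (x - y) + norm (x - y) * (1/2)"
        by (intro norm_triangle_mono order_trans[OF norm_mult_ineq] mult_mono x y) auto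
      ultimately show "dist (f x) (f y) \<le> (1/2) * dist x y"
        by (simp add: dist_norm)
    qed
  qed auto
  then obtain y where y: "y \<in> T" "f y = y" by blast
  have "h + y * y = 2 *\<^sub>R y"
    using arg_cong[OF y(2), of "\<lambda>z. 2 *\<^sub>R z"] by (simp add: f_def)
  then have "(1 - y) * (1 - y) = 1 - h"
    by (simp add: algebra_simps scaleR_2)
  with y(1) show ?thesis by (intro that[of y]) (auto simp: T_def)
qed

text \<open>A fixed point \<open>z\<close> of the contraction \<open>z \<mapsto> 1 + y * z\<close>
  is a right inverse of \<open>1 - y\<close>. Its adjoint is a left inverse, so the two
  coincide.\<close>

lemma self_adjoint_inverse:
  fixes y :: "'a::unital_cstar"
  assumes y: "star y = y" and le: "norm y \<le> 1/2"
  obtains z where "star z = z" "(1 - y) * z = 1" "z * (1 - y) = 1"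
proof -
  have "\<exists>!z\<in>UNIV. 1 + y * z = z"
  proof (rule Banach_fix[of _ "1/2"])
    show "dist (1 + y * x) (1 + y * z) \<le> (1/2) * dist x z" for x z
    proof -
      have "norm (y * (x - z)) \<le> (1/2) * norm (x - z)"
        by (intro order_trans[OF norm_mult_ineq] mult_mono le) auto
      then show "dist (1 + y * x) (1 + y * z) \<le> (1/2) * dist x z"
        by (simp add: dist_norm right_diff_distrib)
    qed
  qed (auto simp: complete_UNIV)
  then obtain z where z: "1 + y * z = z" by blast
  then have r: "(1 - y) * z = 1" by (simp add: left_diff_distrib) (metis add_diff_cancel_right')
  then have l: "star z * (1 - y) = 1"
    by (metis star_diff star_mult star_one y)
  have "star z = z" using r l by (metis mult.assoc mult_1 mult.right_neutral)
  with r l show ?thesis using that by metis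
qed

text \<open>With a square root \<open>k\<close> of \<open>1 - h\<^sup>2\<close> the element \<open>h + i k\<close> is unitary, so its imaginary part
  \<open>k\<close> is a contraction.\<close>

lemma norm_one_minus_square_le:
  fixes h :: "'a::unital_cstar"
  assumes h: "star h = h" and le: "norm h \<le> 1/2"
  shows "norm (1 - h * h) \<le> 1"
proof -
  have "norm (h * h) \<le> (1/2) * (1/2)"
    by (intro order_trans[OF norm_mult_ineq] mult_mono le) auto
  then obtain y where y: "star y = y" "(1 - y) * (1 - y) = 1 - h * h" "y * h = h * y"
    using self_adjoint_sqrt[of "h * h" h] by (auto simp: star_mult h mult.assoc)
  define k where "k = 1 - y"
  have k: "star k = k" "k * k = 1 - h * h" "k * h = h * k"
    using y by (auto simp: k_def star_diff algebra_simps)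
  define u where "u = h + \<i> *\<^sub>C k"
  have ii: "- ((-1) *\<^sub>C a) = a" "(-1) *\<^sub>C a = - a" for a :: 'a
    by (auto simp: scaleC_minus_left)
  have su: "star u = h + (- \<i>) *\<^sub>C k"
    by (simp add: u_def star_add star_scaleC h k)
  have "star u * u = h * h + k * k + (\<i> *\<^sub>C (h * k) + (- \<i>) *\<^sub>C (h * k))"
    unfolding su unfolding u_def
    by (simp add: algebra_simps scaleC_mult_left scaleC_mult_right scaleC_add_right scaleC_diff_right
        scaleC_minus_left scaleC_scaleC ii k(3))
  also have "\<dots> = 1"
    by (simp add: k flip: scaleC_add_left)
  finally have "norm u = 1" by (rule norm_isometry)
  moreover have "u - star u = (2 * \<i>) *\<^sub>C k"
    unfolding su unfolding u_def
    by (simp add: algebra_simps flip: scaleC_add_left)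
  ultimately have "2 * norm k \<le> 2"
    using norm_triangle_ineq4[of u "star u"] by (simp add: norm_scaleC norm_mult)
  then have "(norm k)\<^sup>2 \<le> 1" by (simp add: power_le_one)
  then show ?thesis using cstar_identity[of k] k by simp
qed

text \<open>For small \<open>t\<close> every
  \<open>1 - (t *\<^sub>R f i) * (t *\<^sub>R f i)\<close> is a contraction, so the sum of these
  \<open>n\<close> terms has norm at most \<open>n\<close>. If the squares summed to
  \<open>- 1\<close>, that sum would be the scalar \<open>n + t * t\<close>.\<close>

lemma sum_of_squares_ne_minus_one:
  fixes f :: "'b \<Rightarrow> 'a::unital_cstar"
  assumes I: "finite I" and sa: "\<And>i. i \<in> I \<Longrightarrow> star (f i) = f i"
  shows "(\<Sum>i\<in>I. f i * f i) \<noteq> - 1"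
proof
  assume eq: "(\<Sum>i\<in>I. f i * f i) = - 1"
  define M where "M = 1 + (\<Sum>i\<in>I. norm (f i))"
  define t where "t = 1 / (2 * M)"
  have M: "M > 0"
    unfolding M_def by (smt (verit) norm_ge_zero sum_nonneg)
  then have t: "t > 0" by (simp add: t_def)
  have "norm (\<Sum>i\<in>I. 1 - (t *\<^sub>R f i) * (t *\<^sub>R f i)) \<le> (\<Sum>i\<in>I. 1)"
  proof (intro sum_norm_le norm_one_minus_square_le)
    fix i assume i: "i \<in> I"
    then show "star (t *\<^sub>R f i) = t *\<^sub>R f i" by (simp add: star_scaleR sa)
    have "norm (f i) \<le> M"
      using member_le_sum[OF i, of "\<lambda>i. norm (f i)"] I by (simp add: M_def)
    then show "norm (t *\<^sub>R f i) \<le> 1/2"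
      using M by (simp add: t_def field_simps)
  qed
  moreover have "(\<Sum>i\<in>I. 1 - (t *\<^sub>R f i) * (t *\<^sub>R f i)) = of_nat (card I) - (t * t) *\<^sub>R (\<Sum>i\<in>I. f i * f i)"
    by (simp add: sum_subtractf scaleR_sum_right)
  ultimately have "norm (of_real (of_nat (card I) + t * t) :: 'a) \<le> of_nat (card I)"
    by (simp add: eq scaleR_conv_of_real)
  then show False using t by (simp only: norm_of_real) (smt (verit) mult_pos_pos of_nat_0_le_iff)
qed

text \<open>If \<open>x\<^sup>* x = -1\<close>, then \<open>- x x\<^sup>*\<close> is a projection, so \<open>x\<^sup>* x + x x\<^sup>* = 2 a\<^sup>2 + 2 b\<^sup>2\<close>
  (for \<open>x = a + i b\<close>) writes \<open>-1\<close> as a sum of squares.\<close>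

lemma star_mult_self_ne_minus_one: "star x * x \<noteq> - (1::'a::unital_cstar)"
proof
  assume eq: "star x * x = - 1"
  define q where "q = x * star x"
  define a where "a = x + star x"
  define b where "b = \<i> *\<^sub>C (x - star x)"
  have sa: "star q = q" "star a = a"
    by (auto simp: q_def a_def star_mult star_star star_add add.commute)
  have sb: "star b = b"
    by (simp add: b_def star_scaleC star_diff star_star scaleC_minus_left scaleC_diff_right)
  have "q * q = x * (star x * x) * star x" by (simp add: q_def mult.assoc)
  then have qq: "q * q = - q" by (simp add: eq q_def)
  have "b * b = (\<i> * \<i>) *\<^sub>C ((x - star x) * (x - star x))"
    by (simp add: b_def scaleC_mult_left scaleC_mult_right scaleC_scaleC)
  also have "\<dots> = - ((x - star x) * (x - star x))"
    using scaleC_of_real[of "-1" "(x - star x) * (x - star x)"] by simp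
  finally have "a * a + b * b = 2 * (star x * x) + 2 * q"
    by (simp add: a_def q_def algebra_simps mult_2)
  \<comment> \<open>Since \<open>q * q = - q\<close>, two copies of \<open>q * q\<close> cancel the
    term \<open>2 * q\<close>.\<close>
  then have sum: "a * a + b * b + q * q + q * q = - (1 + 1)"
    by (simp add: eq qq mult_2 algebra_simps)
  \<comment> \<open>Halving the identity gives \<open>- 1\<close>. The factor \<open>r\<close>
    absorbs the half into \<open>a\<close> and \<open>b\<close>, and the two copies of
    \<open>q * q\<close> merge into one.\<close>
  define r where "r = (1 / sqrt 2 :: real)"
  have rr: "r * r = 1/2" by (simp add: r_def)
  define f where "f i = (if i = 0 then r *\<^sub>R a else if i = 1 then r *\<^sub>R b else q)" for i :: nat
  have "q * q = (1/2) *\<^sub>R (q * q + q * q)"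
    by (simp flip: scaleR_2)
  then have "(\<Sum>i\<in>{0,1,2}. f i * f i) = (1/2) *\<^sub>R (a * a + b * b + q * q + q * q)"
    by (simp add: f_def rr scaleR_add_right add.assoc)
  also have "\<dots> = - 1"
    unfolding sum by (simp flip: scaleR_2)
  finally have "(\<Sum>i\<in>{0,1,2}. f i * f i) = - 1" .
  moreover have "star (f i) = f i" for i
    using sa sb by (simp add: f_def star_scaleR)
  ultimately show False
    using sum_of_squares_ne_minus_one[of "{0,1,2}" f] by blast
qed

lemma self_adjoint_inverse_sqrt:
  fixes h :: "'a::unital_cstar"
  assumes h: "star h = h" and le: "norm (h - 1) \<le> 3/4"
  obtains z where "star z = z" "z * h * z = 1"
proof -
  obtain y where y: "star y = y" "norm y \<le> 1/2" "(1 - y) * (1 - y) = h"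
    using self_adjoint_sqrt[of "1 - h" 1] h le by (auto simp: star_diff norm_minus_commute)
  obtain z where z: "star z = z" "(1 - y) * z = 1" "z * (1 - y) = 1"
    using self_adjoint_inverse y by blast
  have "z * h * z = (z * (1 - y)) * ((1 - y) * z)"
    unfolding y(3)[symmetric] by (simp only: mult.assoc)
  then show ?thesis using z that by simp
qed

text \<open>The scalar \<open>c\<close> comes from an approximation that need not be self-adjoint,
  so it is not known to be positive. As \<open>star g * g\<close> is self-adjoint, it is close to
  \<open>c\<close> and to \<open>cnj c\<close>, which forces \<open>Re c\<close> to dominate. A
  negative \<open>Re c\<close> would produce an element \<open>x\<close> with
  \<open>star x * x = - 1\<close>.\<close>

lemma star_mult_self_near_scalar:
  fixes g :: "'a::unital_cstar"
  assumes near: "norm (star g * g - c *\<^sub>C 1) \<le> cmod c / 4" and c: "c \<noteq> 0"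
  shows "\<exists>\<rho>>0. norm ((1 / \<rho>) *\<^sub>R (star g * g) - 1) \<le> 3/4"
proof -
  define w where "w = star g * g"
  define \<rho> where "\<rho> = Re c"
  have w: "star w = w" by (simp add: w_def star_mult star_star)
  have near': "norm (w - cnj c *\<^sub>C 1) \<le> cmod c / 4"
    using near norm_star[of "w - c *\<^sub>C 1"] by (simp add: star_diff star_scaleC w w_def[symmetric])
  have "c + cnj c = complex_of_real (2 * \<rho>)" "c - cnj c = \<i> * complex_of_real (2 * Im c)"
    by (auto simp: complex_eq_iff \<rho>_def)
  then have sum: "c *\<^sub>C (1::'a) + cnj c *\<^sub>C 1 = (2 * \<rho>) *\<^sub>R 1"
    and diff: "c *\<^sub>C (1::'a) - cnj c *\<^sub>C 1 = (\<i> * complex_of_real (2 * Im c)) *\<^sub>C 1"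
    by (metis scaleC_add_left scaleC_of_real)
      (metis scaleC_add_left scaleC_minus_left \<open>c - cnj c = _\<close> diff_conv_add_uminus)
  have "2 *\<^sub>R (w - \<rho> *\<^sub>R 1) = (w - c *\<^sub>C 1) + (w - cnj c *\<^sub>C 1)"
    using sum by (simp add: algebra_simps scaleR_2)
  then have "2 * norm (w - \<rho> *\<^sub>R 1) \<le> norm (w - c *\<^sub>C 1) + norm (w - cnj c *\<^sub>C 1)"
    by (metis norm_triangle_ineq norm_scaleR abs_numeral)
  then have w\<rho>: "norm (w - \<rho> *\<^sub>R 1) \<le> cmod c / 4"
    using near near' by (simp add: w_def)
  have "norm (c *\<^sub>C (1::'a) - cnj c *\<^sub>C 1) \<le> norm (w - cnj c *\<^sub>C 1) + norm (w - c *\<^sub>C 1)"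
    using norm_triangle_ineq4[of "w - cnj c *\<^sub>C 1" "w - c *\<^sub>C 1"] by simp
  then have "2 * \<bar>Im c\<bar> \<le> cmod c / 2"
    using near near' unfolding diff by (simp add: norm_scaleC norm_mult w_def)
  moreover have "cmod c \<le> \<bar>\<rho>\<bar> + \<bar>Im c\<bar>" by (simp add: \<rho>_def cmod_le)
  ultimately have \<rho>_ge: "\<bar>\<rho>\<bar> \<ge> 3 * cmod c / 4" by simp
  then have \<rho>0: "\<rho> \<noteq> 0" using c by auto
  have "(1 / \<rho>) *\<^sub>R w - 1 = (1 / \<rho>) *\<^sub>R (w - \<rho> *\<^sub>R 1)"
    using \<rho>0 by (simp add: scaleR_diff_right)
  then have "norm ((1 / \<rho>) *\<^sub>R w - 1) = norm (w - \<rho> *\<^sub>R 1) / \<bar>\<rho>\<bar>" by simp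
  also have "\<dots> \<le> 3/4"
    using w\<rho> \<rho>_ge \<rho>0 by (simp add: divide_le_eq)
  finally have le: "norm ((1 / \<rho>) *\<^sub>R w - 1) \<le> 3/4" .
  have "\<rho> > 0"
  proof (rule ccontr)
    assume "\<not> \<rho> > 0"
    then have neg: "- \<rho> > 0" using \<rho>0 by simp
    obtain z where z: "star z = z" "z * ((1 / \<rho>) *\<^sub>R w) * z = 1"
      using self_adjoint_inverse_sqrt[OF _ le] by (auto simp: star_scaleR w)
    \<comment> \<open>Scaling by the positive number \<open>- \<rho>\<close> instead of
      \<open>\<rho>\<close> turns the normalised value 1 into \<open>- 1\<close>.\<close>
    define x where "x = (1 / sqrt (- \<rho>)) *\<^sub>R (g * z)"
    have "star x * x = (1 / (- \<rho>)) *\<^sub>R (z * w * z)"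
      using neg by (simp add: x_def star_scaleR star_mult z w_def mult.assoc)
    also have "\<dots> = - (z * ((1 / \<rho>) *\<^sub>R w) * z)" by simp
    also have "\<dots> = - 1" by (simp only: z)
    finally show False using star_mult_self_ne_minus_one by blast
  qed
  then show ?thesis using le by (auto simp: w_def)
qed

section \<open>Infinite projections and hereditary subalgebras\<close>

lemma infinite_projection_isometry:
  fixes x w :: "'a::unital_cstar"
  assumes x: "star x * x = 1" and w: "star w * w = 1" and nonunitary: "w * star w \<noteq> 1"
  shows "infinite_projection (x * star x)"
proof -
  have xc: "star x * (x * a) = a" for a by (simp add: x flip: mult.assoc)
  have wc: "star w * (w * a) = a" for a by (simp add: w flip: mult.assoc)
  define q where "q = x * w * star w * star x"
  \<comment> \<open>This transports the isometry \<open>w\<close> to the corner of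
    \<open>x * star x\<close>. Compressing its range projection \<open>q\<close> by \<open>x\<close>
    recovers \<open>w * star w\<close>, so \<open>q\<close> is proper.\<close>
  define u where "u = x * w * star x"
  have "is_projection (x * star x)" "is_projection q"
    by (auto simp: is_projection_def q_def star_mult star_star mult.assoc xc wc)
  moreover have "cle q (x * star x)"
  proof -
    define d where "d = x * star x - q"
    have "star d * d = d"
      by (simp add: d_def q_def star_diff star_mult star_star algebra_simps xc wc)
    then show ?thesis unfolding cle_def cpositive_def d_def[symmetric] by metis
  qed
  moreover have "q \<noteq> x * star x"
  proof
    assume "q = x * star x"
    then have "star x * q * x = star x * (x * star x) * x" by simp
    then have "w * star w = 1" by (simp add: q_def mult.assoc xc x)
    then show False using nonunitary by simp
  qed
  moreover have "star u * u = x * star x" "u * star u = q"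
    by (auto simp: u_def q_def star_mult star_star mult.assoc xc wc)
  ultimately show ?thesis unfolding infinite_projection_def by blast
qed

text \<open>For \<open>K\<close> larger than the norm of \<open>y * star y\<close>, the positive
  element \<open>(b * y) * star (b * y)\<close> lies below \<open>K *\<^sub>R (b * star b)\<close>,
  an element of \<open>B\<close>. The factor 2 in \<open>K\<close> keeps \<open>h\<close> small
  enough for a square root of \<open>1 - h\<close>, which exhibits the difference as
  \<open>star m * m\<close>.\<close>

lemma hereditary_conjugate:
  fixes b y :: "'a::unital_cstar"
  assumes B: "hereditary_subalgebra B" and b: "b \<in> B"
  shows "(b * y) * star (b * y) \<in> B"
proof -
  define K where "K = 2 * (norm (y * star y) + 1)"
  have K: "K > 0" by (simp add: K_def add_nonneg_pos)
  define h where "h = (1 / K) *\<^sub>R (y * star y)"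
  have "norm h \<le> 3/4" using K by (simp add: h_def K_def divide_le_eq)
  moreover have "star h = h" by (simp add: h_def star_scaleR star_mult star_star)
  ultimately obtain k where k: "star k = k" "(1 - k) * (1 - k) = 1 - h"
    using self_adjoint_sqrt[of h 1] by auto
  define m where "m = sqrt K *\<^sub>R ((1 - k) * star b)"
  have "star m * m = K *\<^sub>R (b * ((1 - k) * (1 - k)) * star b)"
    using K by (simp add: m_def star_scaleR star_mult star_star star_diff k(1) mult.assoc)
  also have "\<dots> = K *\<^sub>R (b * star b) - (b * y) * star (b * y)"
    using K unfolding k(2) by (simp add: h_def algebra_simps star_mult)
  finally have "cle ((b * y) * star (b * y)) (K *\<^sub>R (b * star b))"
    unfolding cle_def cpositive_def by metis
  moreover have "cpositive ((b * y) * star (b * y))"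
    unfolding cpositive_def by (metis star_star)
  moreover have "K *\<^sub>R (b * star b) \<in> B"
    using B b unfolding hereditary_subalgebra_def cstar_subalgebra_def csubspace_def
    by (metis scaleC_of_real)
  ultimately show ?thesis using B unfolding hereditary_subalgebra_def by blast
qed

section \<open>Principal right ideals\<close>

lemma mem_principal_right: "x \<in> principal_right s \<longleftrightarrow> (\<exists>t. x = s * t)"
  by (auto simp: principal_right_def lmult_def)

lemma mult_mem_principal_right [simp]: "s * t \<in> principal_right s"
  by (auto simp: mem_principal_right)

lemma principal_right_mono: "x \<in> principal_right s \<Longrightarrow> principal_right x \<subseteq> principal_right s"
  by (auto simp: mem_principal_right mult.assoc)

lemma principal_right_mult: "principal_right (s * t) = lmult s (principal_right t)"
  by (auto simp: principal_right_def lmult_def mult.assoc)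

lemma disjoint_principal_right_mult:
  assumes "left_cancellative TYPE('s::semigroup_mult)"
  shows "principal_right (c * a) \<inter> principal_right (c * b) = {} \<longleftrightarrow>
    principal_right a \<inter> principal_right (b::'s) = {}"
  using assms unfolding disjoint_iff mem_principal_right left_cancellative_def
  by (metis mult.assoc)

lemma lmult_lpreimage: "lmult p (lpreimage p X) = X \<inter> principal_right p"
  by (auto simp: lmult_def lpreimage_def mem_principal_right)

lemma identity_if_right_unit:
  fixes s :: "'s::semigroup_mult"
  assumes lc: "left_cancellative TYPE('s)" and rc: "right_cancellative TYPE('s)"
    and eq: "y = y * s"
  shows "is_identity s"
proof -
  have "s * a = a" for a
    using lc eq unfolding left_cancellative_def by (metis mult.assoc)
  moreover from this have "a * s = a" for a
    using rc unfolding right_cancellative_def by (metis mult.assoc)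
  ultimately show ?thesis by (simp add: is_identity_def)
qed

text \<open>Without an identity, \<open>y \<in> y'S\<close> would be a strict order on a finite set of generators of \<open>S\<close>
  having no maximal element.\<close>

lemma no_finite_principal_cover:
  fixes Y :: "'s::semigroup_mult set"
  assumes lc: "left_cancellative TYPE('s)" and rc: "right_cancellative TYPE('s)"
    and no_id: "\<nexists>u::'s. is_identity u" and Y: "finite Y"
  shows "(\<Union>y\<in>Y. principal_right y) \<noteq> UNIV"
proof
  assume cover: "(\<Union>y\<in>Y. principal_right y) = UNIV"
  define R where "R x y \<longleftrightarrow> x \<in> principal_right y" for x y :: 's
  have irrefl: "\<not> R x x" for x
    using identity_if_right_unit[OF lc rc] no_id by (auto simp: R_def mem_principal_right)
  have trans: "R x y \<Longrightarrow> R y z \<Longrightarrow> R x z" for x y z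
    using principal_right_mono by (auto simp: R_def)
  have "Y \<noteq> {}" using cover by auto
  moreover have "asymp_on Y R"
    using irrefl trans by (intro asymp_onI) blast
  moreover have "transp_on Y R"
    by (intro transp_onI) (rule trans)
  ultimately obtain m where "m \<in> Y" "\<forall>x\<in>Y. x \<noteq> m \<longrightarrow> \<not> R m x"
    using Finite_Set.bex_max_element[OF Y] by blast
  moreover obtain y where "y \<in> Y" "R m y" using cover by (auto simp: R_def)
  ultimately show False using irrefl by metis
qed

text \<open>If the two principal ideals differ, one is not contained in the other and (D3) separates
  them. If they agree, \<open>t\<close> and \<open>t'\<close> differ by a nontrivial unit, and the
  conditions on units move some principal ideal off itself.\<close>

lemma ex_disjoint_translates:
  fixes t t' :: "'s::semigroup_mult"
  assumes standing: "invertibles = ({} :: 's set) \<longrightarrow>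
      (\<forall>a b :: 's. principal_right a = principal_right b \<longrightarrow> a = b)"
    and lc: "left_cancellative TYPE('s)" and rc: "right_cancellative TYPE('s)"
    and D3: "cond_D3 TYPE('s)"
    and cases:
      "(finite (invertibles :: 's set) \<and> card (invertibles :: 's set) \<le> 1) \<or>
       (\<not> (finite (invertibles :: 's set) \<and> card (invertibles :: 's set) \<le> 1) \<and>
          cond_D2 TYPE('s)) \<or>
       (\<not> (finite (invertibles :: 's set) \<and> card (invertibles :: 's set) \<le> 1) \<and>
          cond_D1 TYPE('s) \<and> strongly_effective TYPE('s))"
    and neq: "t \<noteq> t'"
  shows "\<exists>z. principal_right (t * z) \<inter> principal_right (t' * z) = {}"
proof (cases "principal_right t = principal_right t'")
  case False
  have *: "\<exists>z. principal_right (a * z) \<inter> principal_right b = {}"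
    if "\<not> principal_right a \<subseteq> principal_right b" for a b :: 's
  proof -
    have "principal_right a \<inter> (UNIV - (\<Union>q\<in>{b}. principal_right q)) \<noteq> {}"
      using that by auto
    then obtain s' where "s' \<in> principal_right a" "principal_right s' \<inter> principal_right b = {}"
      using D3[unfolded cond_D3_def, rule_format, of "{b}" a] by auto
    then show ?thesis by (metis mem_principal_right)
  qed
  have **: "\<exists>z. principal_right (a * z) \<inter> principal_right (b * z) = {}"
    if ab: "\<not> principal_right a \<subseteq> principal_right b" for a b :: 's
  proof -
    obtain z where "principal_right (a * z) \<inter> principal_right b = {}" using *[OF ab] by blast
    moreover have "principal_right (b * z) \<subseteq> principal_right b"
      by (simp add: principal_right_mono)
    ultimately show ?thesis by blast
  qed
  from False consider "\<not> principal_right t \<subseteq> principal_right t'" | "\<not> principal_right t' \<subseteq> principal_right t"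
    by blast
  then show ?thesis
  proof cases
    case 1
    then show ?thesis by (rule **)
  next
    case 2
    show ?thesis using **[OF 2] by (simp only: Int_commute)
  qed
next
  case True
  \<comment> \<open>Without units the standing assumption would give \<open>t = t'\<close>; hence
    \<open>S\<close> has an identity.\<close>
  then have "invertibles \<noteq> ({} :: 's set)" using standing neq by metis
  then obtain u where u: "is_identity (u::'s)" by (auto simp: invertibles_def)
  have uniq: "w = u" if "is_identity w" for w
    using that u unfolding is_identity_def by metis
  have "t \<in> principal_right t'" "t' \<in> principal_right t"
  proof -
    have "t * u = t" "t' * u = t'" using u by (auto simp: is_identity_def)
    then show "t \<in> principal_right t'" "t' \<in> principal_right t"
      using True mult_mem_principal_right[of t u] mult_mem_principal_right[of t' u] by argo+
  qed
  then obtain x y where x: "t' = t * x" and y: "t = t' * y"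
    unfolding mem_principal_right by blast
  have "t * (x * y) = t" "t' * (y * x) = t'"
    by (simp_all only: mult.assoc[symmetric] x[symmetric] y[symmetric])
  moreover have "t * u = t" "t' * u = t'" using u by (auto simp: is_identity_def)
  ultimately have "t * (x * y) = t * u" "t' * (y * x) = t' * u" by simp_all
  then have xy: "x * y = u" "y * x = u"
    using lc unfolding left_cancellative_def by blast+
  then have xinv: "x \<in> invertibles" using u unfolding invertibles_def by blast
  have "u * u = u" using u by (simp add: is_identity_def)
  then have uinv: "u \<in> invertibles" using u unfolding invertibles_def by blast
  have "x \<noteq> u"
  proof
    assume "x = u"
    then show False using x \<open>t * u = t\<close> neq by simp
  qed
  then have nid: "\<not> is_identity x" using uniq by blast
  \<comment> \<open>The distinct units \<open>x\<close> and \<open>u\<close> rule out the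
    alternative with at most one unit.\<close>
  have "\<not> (finite (invertibles :: 's set) \<and> card (invertibles :: 's set) \<le> 1)"
    using xinv uinv \<open>x \<noteq> u\<close> card_le_Suc0_iff_eq[of "invertibles :: 's set"] by auto
  then consider "cond_D2 TYPE('s)" | "cond_D1 TYPE('s)" "strongly_effective TYPE('s)"
    using cases by blast
  then have "\<exists>z. principal_right z \<inter> lmult x (principal_right z) = {}"
  proof cases
    case 1
    have "lpreimage u X = X" for X :: "'s set"
      using u by (auto simp: lpreimage_def is_identity_def)
    moreover have "u \<in> principal_right u"
      using u by (auto simp: mem_principal_right is_identity_def)
    ultimately show ?thesis
      using 1[unfolded cond_D2_def, rule_format, of u u "{}" x] xinv nid by auto
  next
    case 2
    \<comment> \<open>By strong effectiveness \<open>x\<close> does not fix this ideal, so by (D1)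
      it moves the ideal to a disjoint one.\<close>
    obtain q where q: "lmult x (principal_right q) \<noteq> principal_right q"
      using 2(2) xinv nid unfolding strongly_effective_def by blast
    have "principal_right q \<in> constructible"
      by (simp add: principal_right_def constructible.intros)
    then show ?thesis
      using 2(1) xinv q unfolding cond_D1_def by blast
  qed
  then obtain z where "principal_right z \<inter> principal_right (x * z) = {}"
    by (auto simp: principal_right_mult)
  then show ?thesis
    using disjoint_principal_right_mult[OF lc, of t z "x * z"]
    unfolding x by (metis mult.assoc)
qed

text \<open>Pairs are treated one after another. Right cancellation keeps the next pair distinct
  after multiplication by \<open>z0\<close>, and further right factors only shrink ideals already
  made disjoint.\<close>

lemma ex_disjoint_translates_finite:
  fixes T :: "('s::semigroup_mult \<times> 's) set"
  assumes rc: "right_cancellative TYPE('s)"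
    and sep: "\<And>t t' :: 's. t \<noteq> t' \<Longrightarrow> \<exists>z. principal_right (t * z) \<inter> principal_right (t' * z) = {}"
    and "finite T" "\<And>t t'. (t, t') \<in> T \<Longrightarrow> t \<noteq> t'"
  shows "\<exists>z. \<forall>(t, t')\<in>T. principal_right (t * z) \<inter> principal_right (t' * z) = {}"
  using assms(3,4)
proof (induction T rule: finite_induct)
  case (insert tt T)
  obtain t t' where tt: "tt = (t, t')" by fastforce
  obtain z0 where z0: "\<forall>(t, t')\<in>T. principal_right (t * z0) \<inter> principal_right (t' * z0) = {}"
    using insert by blast
  have "t * z0 \<noteq> t' * z0"
    using insert.prems[of t t'] rc tt by (auto simp: right_cancellative_def)
  then obtain z where z: "principal_right (t * z0 * z) \<inter> principal_right (t' * z0 * z) = {}"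
    using sep by blast
  have "principal_right (a * (z0 * z)) \<subseteq> principal_right (a * z0)" for a
    by (metis mult.assoc mult_mem_principal_right principal_right_mono)
  then have "\<forall>(t, t')\<in>insert tt T. principal_right (t * (z0 * z)) \<inter> principal_right (t' * (z0 * z)) = {}"
    using z0 z tt by (fastforce simp: mult.assoc)
  then show ?case by blast
qed simp

text \<open>Elements of \<open>S \<union> {1}\<close> are encoded as in \<^const>\<open>unitise\<close>.\<close>

definition principal_unitised :: "'s::semigroup_mult option \<Rightarrow> 's set" where
  "principal_unitised p = (case p of None \<Rightarrow> UNIV | Some s \<Rightarrow> principal_right s)"

lemma principal_unitised_simps [simp]:
  "principal_unitised None = UNIV" "principal_unitised (Some s) = principal_right s"
  by (simp_all add: principal_unitised_def)

lemma principal_unitised_mono: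
  "x \<in> principal_unitised p \<Longrightarrow> principal_right x \<subseteq> principal_unitised p"
  by (cases p) (auto dest: principal_right_mono)

lemma constructible_principal_unitised [simp]: "principal_unitised p \<in> constructible"
  by (cases p) (auto simp: principal_right_def constructible.intros)

lemma principal_unitised_Int:
  assumes "right_LCM TYPE('s::semigroup_mult)"
  shows "principal_unitised p \<inter> principal_unitised q = {} \<or>
    (\<exists>r. principal_unitised p \<inter> principal_unitised q = principal_unitised (r :: 's option))"
proof (cases p)
  case None
  then show ?thesis by auto
next
  case p: (Some a)
  show ?thesis
  proof (cases q)
    case None
    then show ?thesis by auto
  next
    case (Some b)
    then show ?thesis
      using assms p unfolding right_LCM_def by (metis principal_unitised_simps(2))
  qed
qed

text \<open>For \<open>r = 1\<close> condition (D3) is applied to \<open>q\<^sub>0\<close> and \<open>q\<^sub>0 F\<close>, and \<open>q\<^sub>0\<close> is cancelled.\<close>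

lemma cond_D3_unitised:
  fixes r :: "'s::semigroup_mult option"
  assumes lc: "left_cancellative TYPE('s)" and D3: "cond_D3 TYPE('s)"
    and F: "finite F" and sub: "\<not> principal_unitised r \<subseteq> \<Union>(principal_unitised ` F)"
  shows "\<exists>s\<in>principal_unitised r. \<forall>q\<in>F. principal_right s \<inter> principal_unitised q = {}"
proof -
  have "None \<notin> F" using sub by auto
  define G where "G = {q. Some q \<in> F}"
  have FG: "F = Some ` G"
    using \<open>None \<notin> F\<close> unfolding G_def image_def by (auto, metis option.exhaust)
  have G: "finite G" using F by (simp add: FG finite_image_iff)
  show ?thesis
  proof (cases r)
    case (Some s)
    then show ?thesis
      using D3[unfolded cond_D3_def, rule_format, of G s] sub G by (auto simp: FG)
  next
    case None
    define q0 :: 's where "q0 = undefined"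
    obtain x where x: "\<And>q. q \<in> G \<Longrightarrow> x \<notin> principal_right q" using sub None by (auto simp: FG)
    have "q0 * x \<notin> principal_right (q0 * q)" if "q \<in> G" for q
      using x[OF that] lc by (auto simp: mem_principal_right left_cancellative_def mult.assoc)
    then have "q0 * x \<in> principal_right q0 \<inter> (UNIV - (\<Union>q\<in>(*) q0 ` G. principal_right q))"
      by auto
    then obtain s' where s': "s' \<in> principal_right q0"
      "\<And>q. q \<in> G \<Longrightarrow> principal_right s' \<inter> principal_right (q0 * q) = {}"
      using D3[unfolded cond_D3_def, rule_format, of "(*) q0 ` G" q0] G by blast
    obtain t where "s' = q0 * t" using s'(1) unfolding mem_principal_right by blast
    then have "principal_right t \<inter> principal_right q = {}" if "q \<in> G" for q
      using s'(2)[OF that] disjoint_principal_right_mult[OF lc] by blast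
    then show ?thesis using None by (auto simp: FG)
  qed
qed

section \<open>Projections of constructible ideals\<close>

lemma csubspace_diff: "csubspace W \<Longrightarrow> a \<in> W \<Longrightarrow> b \<in> W \<Longrightarrow> a - b \<in> W"
  unfolding csubspace_def
  by (metis scaleC_minus_left scaleC_one uminus_add_conv_diff add.commute)

lemma cstar_subalgebra_generated: "cstar_subalgebra (cstar_generated X)"
  unfolding cstar_generated_def cstar_subalgebra_def csubspace_def
  by (auto intro!: closed_Inter)

lemma subset_cstar_generated: "X \<subseteq> cstar_generated X"
  by (auto simp: cstar_generated_def)

locale lcm_representation =
  fixes v :: "'s::semigroup_mult \<Rightarrow> 'a::unital_cstar" and e :: "'s set \<Rightarrow> 'a"
  assumes left_cancel: "left_cancellative TYPE('s)"
    and right_cancel: "right_cancellative TYPE('s)"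
    and LCM: "right_LCM TYPE('s)"
    and rel: "semigroup_relations cs_UNIV v e"
begin

lemma v_isometry: "star (v p) * v p = 1"
  and v_mult: "v p * v q = v (p * q)"
  using rel by (auto simp: semigroup_relations_def cs_UNIV_def)

lemma e_self_adjoint: "X \<in> constructible \<Longrightarrow> star (e X) = e X"
  and e_idem: "X \<in> constructible \<Longrightarrow> e X * e X = e X"
  and e_lmult: "X \<in> constructible \<Longrightarrow> v p * e X * star (v p) = e (lmult p X)"
  and e_empty: "e {} = 0"
  and e_UNIV: "e UNIV = 1"
  and e_Int: "X \<in> constructible \<Longrightarrow> Y \<in> constructible \<Longrightarrow> e X * e Y = e (X \<inter> Y)"
  using rel by (auto simp: semigroup_relations_def cs_UNIV_def)

lemma e_commute: "X \<in> constructible \<Longrightarrow> Y \<in> constructible \<Longrightarrow> e X * e Y = e Y * e X"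
  by (simp add: e_Int Int_commute)

lemma e_projection: "X \<in> constructible \<Longrightarrow> is_projection (e X)"
  by (simp add: is_projection_def e_self_adjoint e_idem)

abbreviation V :: "'s option \<Rightarrow> 'a" where
  "V \<equiv> unitise v"

lemma V_isometry: "star (V p) * V p = 1"
  by (cases p) (auto simp: unitise_def v_isometry)

lemma V_cancel: "star (V p) * (V p * x) = x"
  by (simp add: V_isometry flip: mult.assoc)

lemma v_cancel: "star (v p) * (v p * x) = x"
  by (simp add: v_isometry flip: mult.assoc)

lemma V_range: "V p * star (V p) = e (principal_unitised p)"
  using e_lmult[OF constructible.whole]
  by (cases p) (auto simp: unitise_def e_UNIV principal_right_def)

lemma v_range: "v p * star (v p) = e (principal_right p)"
  using V_range[of "Some p"] by (simp add: unitise_def)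

text \<open>By (L2) the right side equals \<open>e\<close> of the part of \<open>X\<close> inside
  \<open>pS\<close>, multiplied by \<open>v p\<close>; the range projection of \<open>v p\<close>
  then disappears.\<close>

lemma e_mult_v:
  assumes "X \<in> constructible"
  shows "e X * v p = v p * e (lpreimage p X)"
proof -
  have c: "lpreimage p X \<in> constructible" "principal_right p \<in> constructible"
    using assms by (auto simp: principal_right_def constructible.intros)
  have "v p * e (lpreimage p X) = v p * e (lpreimage p X) * star (v p) * v p"
    by (simp add: v_isometry mult.assoc)
  also have "\<dots> = e X * (v p * star (v p)) * v p"
    using assms c by (simp add: e_lmult lmult_lpreimage v_range e_Int)
  also have "\<dots> = e X * v p"
    by (simp add: v_isometry mult.assoc)
  finally show ?thesis by simp
qed

lemma star_V_mult_V_disjoint: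
  assumes "principal_unitised p \<inter> principal_unitised q = {}"
  shows "star (V p) * V q = 0"
proof -
  have "star (V p) * V q = star (V p) * (V p * star (V p)) * (V q * star (V q)) * V q"
    by (simp add: V_isometry V_cancel mult.assoc)
  also have "\<dots> = star (V p) * (e (principal_unitised p) * e (principal_unitised q)) * V q"
    by (simp add: V_range mult.assoc)
  also have "\<dots> = 0"
    using assms by (simp add: e_Int e_empty)
  finally show ?thesis .
qed

section \<open>Atoms of finitely many commuting range projections\<close>

definition meet :: "'s option list \<Rightarrow> 'a" where
  "meet ps = prod_list (map (\<lambda>p. e (principal_unitised p)) ps)"

definition gap :: "'s set list \<Rightarrow> 'a" where
  "gap Xs = prod_list (map (\<lambda>X. 1 - e X) Xs)"

text \<open>The products \<open>atom A ps\<close> for \<open>A \<subseteq> set ps\<close> are the minimal projections of the algebra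
  spanned by \<open>V p * star (V p)\<close>, \<open>p \<in> set ps\<close>.\<close>

definition atom :: "'s option set \<Rightarrow> 's option list \<Rightarrow> 'a" where
  "atom A ps = prod_list
     (map (\<lambda>p. if p \<in> A then e (principal_unitised p) else 1 - e (principal_unitised p)) ps)"

text \<open>The right LCM property, extended to the unitisation, keeps a finite intersection either
  empty or principal.\<close>

lemma meet_cases: "meet ps = 0 \<or>
  (\<exists>r. meet ps = e (principal_unitised r) \<and> (\<forall>p\<in>set ps. principal_unitised r \<subseteq> principal_unitised p))"
proof (induction ps)
  case Nil
  show ?case by (auto simp: meet_def e_UNIV intro!: exI[of _ None])
next
  case (Cons p ps)
  have meet: "meet (p # ps) = e (principal_unitised p) * meet ps" by (simp add: meet_def)
  from Cons show ?case
  proof (elim disjE exE conjE)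
    fix r assume r: "meet ps = e (principal_unitised r)"
      "\<forall>p\<in>set ps. principal_unitised r \<subseteq> principal_unitised p"
    have eq: "meet (p # ps) = e (principal_unitised p \<inter> principal_unitised r)"
      by (simp add: meet r e_Int)
    show ?thesis
      using principal_unitised_Int[OF LCM, of p r]
    proof (elim disjE exE)
      fix r' assume r': "principal_unitised p \<inter> principal_unitised r = principal_unitised r'"
      then have "meet (p # ps) = e (principal_unitised r')" by (simp add: eq)
      moreover have "\<forall>q\<in>set (p # ps). principal_unitised r' \<subseteq> principal_unitised q"
        using r r' by auto
      ultimately show ?thesis by blast
    qed (simp add: eq e_empty)
  qed (simp add: meet)
qed

lemma commute_gap:
  assumes "\<And>X. X \<in> set Xs \<Longrightarrow> a * e X = e X * a"
  shows "a * gap Xs = gap Xs * a"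
  using assms
proof (induction Xs)
  case (Cons X Xs)
  have "a * gap (X # Xs) = (a * (1 - e X)) * gap Xs" by (simp add: gap_def mult.assoc)
  also have "\<dots> = (1 - e X) * (a * gap Xs)"
    using Cons.prems[of X] by (simp add: algebra_simps)
  also have "\<dots> = gap (X # Xs) * a" using Cons by (simp add: gap_def mult.assoc)
  finally show ?case .
qed (simp add: gap_def)

lemma commute_atom:
  assumes "\<And>p. a * e (principal_unitised p) = e (principal_unitised p) * a"
  shows "a * atom A ps = atom A ps * a"
proof (induction ps)
  case (Cons p ps)
  define f where "f = (if p \<in> A then e (principal_unitised p) else 1 - e (principal_unitised p))"
  have f: "a * f = f * a" using assms by (simp add: f_def algebra_simps)
  have at: "atom A (p # ps) = f * atom A ps" by (simp add: atom_def f_def)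
  show ?case unfolding at by (metis Cons f mult.assoc)
qed (simp add: atom_def)

lemma commute_meet:
  assumes "\<And>p. a * e (principal_unitised p) = e (principal_unitised p) * a"
  shows "a * meet ps = meet ps * a"
proof (induction ps)
  case (Cons p ps)
  have "meet (p # ps) = e (principal_unitised p) * meet ps" by (simp add: meet_def)
  then show ?case by (metis Cons assms mult.assoc)
qed (simp add: meet_def)

text \<open>Together with \<open>meet_cases\<close> this brings a nonzero atom into the form of one
  principal ideal minus finitely many others, to which \<open>independence\<close> applies.\<close>

lemma atom_split:
  "atom A ps = meet (filter (\<lambda>p. p \<in> A) ps) * gap (map principal_unitised (filter (\<lambda>p. p \<notin> A) ps))"
proof (induction ps)
  case (Cons p ps)
  define f where "f = (if p \<in> A then e (principal_unitised p) else 1 - e (principal_unitised p))"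
  let ?m = "meet (filter (\<lambda>p. p \<in> A) ps)"
  let ?g = "gap (map principal_unitised (filter (\<lambda>p. p \<notin> A) ps))"
  have eq: "atom A (p # ps) = f * (?m * ?g)"
    by (simp add: Cons[symmetric]) (simp add: atom_def f_def)
  have comm: "f * ?m = ?m * f"
    by (rule commute_meet) (use e_commute[of "principal_unitised p"] in \<open>auto simp: f_def algebra_simps\<close>)
  show ?case
  proof (cases "p \<in> A")
    case True
    then show ?thesis by (simp add: eq f_def meet_def mult.assoc)
  next
    case False
    have "atom A (p # ps) = ?m * (f * ?g)"
      by (simp only: eq comm flip: mult.assoc)
    then show ?thesis using False by (simp add: f_def gap_def)
  qed
qed (simp add: atom_def meet_def gap_def)

text \<open>Consequently a linear combination of the range projections acts on an atom as a
  scalar.\<close>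

lemma atom_absorb:
  assumes "p \<in> set ps"
  shows "atom A ps * e (principal_unitised p) = (if p \<in> A then atom A ps else 0)"
proof -
  have comm: "e (principal_unitised p) * atom A qs = atom A qs * e (principal_unitised p)" for qs
    by (rule commute_atom) (simp add: e_commute)
  from assms show ?thesis
  proof (induction ps)
    case (Cons q ps)
    define f where "f = (if q \<in> A then e (principal_unitised q) else 1 - e (principal_unitised q))"
    have at: "atom A (q # ps) = f * atom A ps" by (simp add: atom_def f_def)
    show ?case
    proof (cases "q = p")
      case True
      have "atom A (q # ps) * e (principal_unitised p) = f * e (principal_unitised p) * atom A ps"
        unfolding at by (simp add: mult.assoc comm)
      moreover have "f * e (principal_unitised p) = (if p \<in> A then f else 0)"
        using True by (simp add: f_def e_idem algebra_simps)
      ultimately show ?thesis by (simp add: at)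
    next
      case False
      then show ?thesis using Cons by (simp add: at mult.assoc)
    qed
  qed simp
qed

text \<open>Each projection in turn splits \<open>y\<close> into two compressions, one of which
  keeps the norm. Following these choices through the list leads to an atom.\<close>

lemma norm_atom:
  assumes "distinct ps" "\<And>p. y * e (principal_unitised p) = e (principal_unitised p) * y"
  shows "\<exists>A. norm y \<le> norm (atom A ps * y)"
  using assms
proof (induction ps arbitrary: y)
  case (Cons p ps)
  let ?e = "e (principal_unitised p)"
  have "norm y \<le> max (norm (?e * y)) (norm ((1 - ?e) * y))"
    using Cons.prems by (intro norm_le_max_compression e_projection) auto
  then obtain B where "B = {p} \<or> B = {}"
    and B: "norm y \<le> norm ((if p \<in> B then ?e else 1 - ?e) * y)"
    by (metis insertI1 empty_iff le_max_iff_disj)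
  define f where "f = (if p \<in> B then ?e else 1 - ?e)"
  have f: "f * e (principal_unitised q) = e (principal_unitised q) * f" for q
    using e_commute[of "principal_unitised p" "principal_unitised q"] by (simp add: f_def algebra_simps)
  have "(f * y) * e (principal_unitised q) = e (principal_unitised q) * (f * y)" for q
    by (metis Cons.prems(2) f mult.assoc)
  then obtain A where A: "norm (f * y) \<le> norm (atom A ps * (f * y))"
    using Cons.IH[of "f * y"] Cons.prems(1) by auto
  \<comment> \<open>The choice at \<open>p\<close> overrides that of \<open>A\<close>. By
    distinctness \<open>p\<close> does not recur in \<open>ps\<close>, so the atom of the tail is
    unchanged.\<close>
  define A' where "A' = (A - {p}) \<union> B"
  have "p \<notin> set ps" using Cons.prems by simp
  then have "atom A' ps = atom A ps"
    using \<open>B = {p} \<or> B = {}\<close> unfolding atom_def A'_def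
    by (intro arg_cong[of _ _ prod_list] map_cong) auto
  moreover have "atom A' (p # ps) = f * atom A' ps"
    by (simp add: atom_def f_def A'_def)
  ultimately have "atom A' (p # ps) * y = atom A ps * (f * y)"
    using commute_atom[OF f] by (simp add: mult.assoc[symmetric])
  moreover have "norm y \<le> norm (f * y)" using B by (simp add: f_def)
  ultimately have "norm y \<le> norm (atom A' (p # ps) * y)" using A by simp
  then show ?case by blast
qed (simp add: atom_def)

lemma gap_projection:
  assumes "set Xs \<subseteq> constructible"
  shows "is_projection (gap Xs)"
  using assms
proof (induction Xs)
  case (Cons X Xs)
  have comm: "(1 - e X) * gap Xs = gap Xs * (1 - e X)"
    using Cons.prems by (intro commute_gap) (auto simp: algebra_simps e_commute)
  have "is_projection (1 - e X)"
    using Cons.prems by (auto intro: is_projection_compl e_projection)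
  moreover have "is_projection (gap Xs)" using Cons by simp
  ultimately have "is_projection ((1 - e X) * gap Xs)"
    using comm unfolding is_projection_def star_mult by (metis mult.assoc)
  then show ?case by (simp add: gap_def)
qed (simp add: gap_def is_projection_def)

lemma atom_projection: "is_projection (atom A ps)"
proof (induction ps)
  case (Cons p ps)
  define f where "f = (if p \<in> A then e (principal_unitised p) else 1 - e (principal_unitised p))"
  have "is_projection f" by (simp add: f_def e_projection is_projection_compl)
  moreover have "f * atom A ps = atom A ps * f"
    by (rule commute_atom) (use e_commute[of "principal_unitised p"] in \<open>auto simp: f_def algebra_simps\<close>)
  ultimately have "is_projection (f * atom A ps)"
    using Cons unfolding is_projection_def star_mult by (metis mult.assoc)
  then show ?case by (simp add: atom_def f_def)
qed (simp add: atom_def is_projection_def)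

lemma gap_absorb:
  assumes "set Xs \<subseteq> constructible" "X \<in> constructible" "Y \<in> set Xs" "X \<subseteq> Y"
  shows "e X * gap Xs = 0"
  using assms
proof (induction Xs)
  case (Cons Z Xs)
  have "e X * gap (Z # Xs) = (e X - e (X \<inter> Z)) * gap Xs"
    using Cons.prems by (simp add: gap_def e_Int right_diff_distrib flip: mult.assoc)
  moreover have "\<dots> = (1 - e Z) * (e X * gap Xs)"
    using Cons.prems by (simp add: e_Int e_commute left_diff_distrib Int_commute flip: mult.assoc)
  ultimately show ?case
    using Cons by (cases "Y = Z") (auto simp: Int_absorb2)
qed simp

lemma gap_mult_v:
  assumes "set Xs \<subseteq> constructible"
  shows "gap Xs * v p = v p * gap (map (lpreimage p) Xs)"
  using assms
proof (induction Xs)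
  case (Cons X Xs)
  have "(1 - e X) * v p = v p * (1 - e (lpreimage p X))"
    using Cons.prems by (simp add: algebra_simps e_mult_v)
  then show ?case using Cons by (simp add: gap_def mult.assoc) (simp flip: mult.assoc)
qed (simp add: gap_def)

lemma gap_in_diagonal:
  assumes "set Xs \<subseteq> constructible"
  shows "gap Xs \<in> diagonal e"
proof -
  have D: "cstar_subalgebra (diagonal e)"
    by (simp add: diagonal_def cstar_subalgebra_generated)
  have e: "X \<in> constructible \<Longrightarrow> e X \<in> diagonal e" for X
    unfolding diagonal_def by (meson imageI subsetD subset_cstar_generated)
  have one: "1 \<in> diagonal e"
    using e[OF constructible.whole] by (simp add: e_UNIV)
  from assms show ?thesis
  proof (induction Xs)
    case (Cons X Xs)
    then have "1 - e X \<in> diagonal e" "gap Xs \<in> diagonal e"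
      using D one e by (auto simp: cstar_subalgebra_def intro: csubspace_diff)
    then show ?case
      using D by (simp add: cstar_subalgebra_def gap_def)
  qed (simp add: gap_def one)
qed

end

section \<open>Faithful expectations and compression\<close>

lemma identity_if_left_unit:
  fixes s :: "'s::semigroup_mult"
  assumes lc: "left_cancellative TYPE('s)" and rc: "right_cancellative TYPE('s)"
    and eq: "s * t = t"
  shows "is_identity s"
proof -
  have "t * s * t = t * t" by (simp only: eq mult.assoc)
  then have "t = t * s" using rc unfolding right_cancellative_def by metis
  then show ?thesis by (rule identity_if_right_unit[OF lc rc])
qed

definition unitised_mult :: "'s::semigroup_mult option \<Rightarrow> 's \<Rightarrow> 's" where
  "unitised_mult p t = (case p of None \<Rightarrow> t | Some s \<Rightarrow> s * t)"

lemma mem_principal_unitised: "s \<in> principal_unitised p \<longleftrightarrow> (\<exists>t. s = unitised_mult p t)"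
  by (cases p) (auto simp: unitised_mult_def mem_principal_right)

text \<open>Right cancellation survives adjoining 1: \<open>None\<close> is available only when
  \<open>S\<close> has no identity, and then \<open>s * t = t\<close> is impossible.\<close>

lemma unitised_mult_right_cancel:
  fixes t :: "'s::semigroup_mult"
  assumes lc: "left_cancellative TYPE('s)" and rc: "right_cancellative TYPE('s)"
    and pq: "p \<in> unitisation" "q \<in> unitisation"
    and eq: "unitised_mult p t = unitised_mult q t"
  shows "p = q"
proof -
  have no_id: "\<nexists>u::'s. is_identity u" if "None \<in> (unitisation :: 's option set)"
    using that by (auto simp: unitisation_def split: if_splits)
  have *: "s * t \<noteq> t" if "None \<in> (unitisation :: 's option set)" for s
    using identity_if_left_unit[OF lc rc] no_id[OF that] by blast
  have "s = s'" if "s * t = s' * t" for s s'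
    using that rc unfolding right_cancellative_def by blast
  then show ?thesis
    using eq pq * by (cases p; cases q) (auto simp: unitised_mult_def dest: sym)
qed

locale faithful_expectation = lcm_representation v e
  for v :: "'s::semigroup_mult \<Rightarrow> 'a::unital_cstar" and e :: "'s set \<Rightarrow> 'a" +
  fixes \<Phi> :: "'a \<Rightarrow> 'a"
  assumes dense: "closed_cspan {unitise v p * star (unitise v q) | p q.
      p \<in> unitisation \<and> q \<in> unitisation} = UNIV"
    and expectation: "conditional_expectation (diagonal e) \<Phi>"
    and faithful: "faithful_on_positives \<Phi>"
    and \<Phi>_unitise: "\<And>p q. p \<in> unitisation \<Longrightarrow> q \<in> unitisation \<Longrightarrow>
      \<Phi> (unitise v p * star (unitise v q)) =
        (if p = q then unitise v p * star (unitise v p) else 0)"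
begin

lemma \<Phi>_add: "\<Phi> (a + b) = \<Phi> a + \<Phi> b"
  and \<Phi>_scaleC: "\<Phi> (z *\<^sub>C a) = z *\<^sub>C \<Phi> a"
  and \<Phi>_diagonal: "d \<in> diagonal e \<Longrightarrow> \<Phi> d = d"
  and norm_\<Phi>_le: "norm (\<Phi> a) \<le> norm a"
  using expectation unfolding conditional_expectation_def by blast+

lemma \<Phi>_zero [simp]: "\<Phi> 0 = 0"
  using norm_\<Phi>_le[of 0] by simp

lemma \<Phi>_diff: "\<Phi> (a - b) = \<Phi> a - \<Phi> b"
  using \<Phi>_add[of "a - b" b] by simp

lemma continuous_on_\<Phi>:
  assumes "continuous_on S f"
  shows "continuous_on S (\<lambda>x. \<Phi> (f x))"
proof -
  have "((\<lambda>x. \<Phi> (X x)) \<longlongrightarrow> \<Phi> l) F" if "(X \<longlongrightarrow> l) F" for X :: "'b \<Rightarrow> 'a" and l F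
    using that unfolding tendsto_iff dist_norm
    by (auto simp flip: \<Phi>_diff elim!: eventually_mono intro: le_less_trans[OF norm_\<Phi>_le])
  then show ?thesis using assms by (auto simp: continuous_on_def)
qed

text \<open>Density becomes an induction principle: a closed linear condition need only be tested on
  the products \<open>V p * star (V q)\<close>.\<close>

lemma in_closed_csubspace:
  assumes "csubspace W" "closed W"
    and "\<And>p q. p \<in> unitisation \<Longrightarrow> q \<in> unitisation \<Longrightarrow> V p * star (V q) \<in> W"
  shows "x \<in> W"
proof -
  have "closed_cspan {V p * star (V q) | p q. p \<in> unitisation \<and> q \<in> unitisation} \<subseteq> W"
    unfolding closed_cspan_def using assms by (intro Inter_lower) auto
  then show ?thesis using dense by auto
qed

section \<open>Finite approximation and vanishing off the diagonal\<close>

definition combination :: "(complex \<times> 's option \<times> 's option) list \<Rightarrow> 'a" where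
  "combination xs = sum_list (map (\<lambda>(l, p, q). l *\<^sub>C (V p * star (V q))) xs)"

lemma combination_approx:
  assumes "\<epsilon> > 0"
  shows "\<exists>xs. set xs \<subseteq> UNIV \<times> unitisation \<times> unitisation \<and> norm (x - combination xs) < \<epsilon>"
proof -
  define P where "P \<epsilon> x xs \<longleftrightarrow> set xs \<subseteq> UNIV \<times> unitisation \<times> unitisation \<and>
    norm (x - combination xs) < \<epsilon>" for \<epsilon> x xs
  define W where "W = {x. \<forall>\<epsilon>>0. \<exists>xs. P \<epsilon> x xs}"
  have "x \<in> W"
  proof (rule in_closed_csubspace)
    show "csubspace W"
      unfolding csubspace_def
    proof (intro conjI ballI allI)
      show "0 \<in> W" by (auto simp: W_def P_def combination_def intro!: exI[of _ "[]"])
    next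
      fix a b assume ab: "a \<in> W" "b \<in> W"
      have "\<exists>zs. P \<epsilon> (a + b) zs" if \<epsilon>: "\<epsilon> > 0" for \<epsilon>
      proof -
        obtain xs ys where "P (\<epsilon>/2) a xs" "P (\<epsilon>/2) b ys"
          using ab half_gt_zero[OF \<epsilon>] unfolding W_def by blast
        moreover have "norm (a + b - combination (xs @ ys))
            \<le> norm (a - combination xs) + norm (b - combination ys)"
          using norm_triangle_ineq[of "a - combination xs" "b - combination ys"]
          by (simp add: combination_def algebra_simps)
        ultimately have "P \<epsilon> (a + b) (xs @ ys)" by (simp add: P_def)
        then show ?thesis ..
      qed
      then show "a + b \<in> W" by (simp add: W_def)
    next
      fix z a assume a: "a \<in> W"
      have "\<exists>zs. P \<epsilon> (z *\<^sub>C a) zs" if \<epsilon>: "\<epsilon> > 0" for \<epsilon>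
      proof -
        \<comment> \<open>Adding 1 keeps the denominator positive when \<open>z = 0\<close>.\<close>
        have pos: "\<epsilon> / (cmod z + 1) > 0"
          using \<epsilon> by (intro divide_pos_pos add_nonneg_pos) auto
        then obtain xs where xs: "P (\<epsilon> / (cmod z + 1)) a xs"
          using a unfolding W_def by blast
        define ys where "ys = map (\<lambda>(l, p, q). (z * l, p, q)) xs"
        have "combination ys = z *\<^sub>C combination xs"
          unfolding ys_def combination_def
          by (induction xs) (auto simp: scaleC_add_right scaleC_scaleC)
        then have "norm (z *\<^sub>C a - combination ys) = cmod z * norm (a - combination xs)"
          by (simp add: norm_scaleC flip: scaleC_diff_right)
        also have "\<dots> \<le> (cmod z + 1) * norm (a - combination xs)"
          by (intro mult_right_mono) auto
        also have "\<dots> < \<epsilon>"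
          using xs by (simp add: P_def pos_less_divide_eq add_nonneg_pos mult.commute)
        finally have "P \<epsilon> (z *\<^sub>C a) ys"
          using xs by (auto simp: P_def ys_def)
        then show ?thesis ..
      qed
      then show "z *\<^sub>C a \<in> W" by (simp add: W_def)
    qed
  next
    show "closed W"
      unfolding closure_subset_eq[symmetric]
    proof
      fix x assume "x \<in> closure W"
      then have x: "\<forall>\<epsilon>>0. \<exists>y\<in>W. dist y x < \<epsilon>"
        by (simp add: closure_approachable)
      have "\<exists>zs. P \<epsilon> x zs" if \<epsilon>: "\<epsilon> > 0" for \<epsilon>
      proof -
        obtain y where y: "y \<in> W" "dist y x < \<epsilon>/2" using x half_gt_zero[OF \<epsilon>] by blast
        obtain xs where xs: "P (\<epsilon>/2) y xs" using y half_gt_zero[OF \<epsilon>] unfolding W_def by blast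
        have "norm (x - combination xs) \<le> norm (x - y) + norm (y - combination xs)"
          using norm_triangle_ineq[of "x - y" "y - combination xs"] by simp
        then have "P \<epsilon> x xs"
          using xs y by (simp add: P_def dist_norm norm_minus_commute)
        then show ?thesis ..
      qed
      then show "x \<in> W" by (simp add: W_def)
    qed
  next
    fix p q :: "'s option" assume "p \<in> unitisation" "q \<in> unitisation"
    then have "P \<epsilon> (V p * star (V q)) [(1, p, q)]" if "\<epsilon> > 0" for \<epsilon>
      using that by (simp add: P_def combination_def)
    then show "V p * star (V q) \<in> W" by (auto simp: W_def)
  qed
  then show ?thesis using assms by (simp add: W_def P_def)
qed

lemma \<Phi>_off_diagonal:
  assumes no_id: "\<nexists>u::'s. is_identity u" and "c \<noteq> q" and "d \<in> diagonal e"
  shows "\<Phi> (v c * d * star (v q)) = 0"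
proof -
  \<comment> \<open>The inner \<open>\<Phi>\<close> leaves only the products with
    \<open>a = b\<close>, where right cancellation gives \<open>w c \<noteq> w q\<close>; for
    distinct \<open>a\<close> and \<open>b\<close>, multiplication by \<open>c\<close> and
    \<open>q\<close> could produce a diagonal product. On \<open>d\<close> the inner
    \<open>\<Phi>\<close> is the identity.\<close>
  define W where "W = {x. \<Phi> (v c * \<Phi> x * star (v q)) = 0}"
  have "d \<in> W"
  proof (rule in_closed_csubspace)
    show "csubspace W"
      by (auto simp: csubspace_def W_def \<Phi>_add \<Phi>_scaleC distrib_left distrib_right
          scaleC_mult_left scaleC_mult_right)
    show "closed W"
      unfolding W_def by (intro closed_Collect_eq continuous_on_\<Phi> continuous_intros)
    fix a b :: "'s option" assume ab: "a \<in> unitisation" "b \<in> unitisation"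
    define w where "w r = (case a of None \<Rightarrow> r | Some s \<Rightarrow> r * s)" for r :: 's
    have w: "v r * V a = V (Some (w r))" for r :: 's
      by (cases a) (auto simp: w_def unitise_def v_mult)
    have "w c \<noteq> w q"
      using \<open>c \<noteq> q\<close> right_cancel by (cases a) (auto simp: w_def right_cancellative_def)
    moreover have "Some (w r) \<in> unitisation" for r :: 's
      using no_id by (simp add: unitisation_def)
    ultimately have "\<Phi> ((v c * V a) * star (v q * V a)) = 0"
      unfolding w using \<Phi>_unitise by simp
    then show "V a * star (V b) \<in> W"
      using ab by (auto simp: W_def \<Phi>_unitise star_mult mult.assoc)
  qed
  then show ?thesis using \<open>d \<in> diagonal e\<close> by (simp add: W_def \<Phi>_diagonal)
qed

text \<open>If \<open>P\<close> is killed by all \<open>v p\<^sup>*\<close>, then the left ideal generated by \<open>P\<close> is spanned by the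
  \<open>v p P\<close> and behaves like \<open>\<ell>\<^sup>2(S \<union> {1})\<close>; there \<open>tS \<subseteq> rS\<close> forces \<open>t \<in> r(S \<union> {1})\<close>.\<close>

lemma principal_right_subset_cases:
  fixes r t :: 's
  assumes no_id: "\<nexists>u::'s. is_identity u"
    and P: "P \<in> diagonal e" "is_projection P" "P \<noteq> 0" and kill: "\<And>p. star (v p) * P = 0"
    and sub: "principal_right t \<subseteq> principal_right r"
  shows "t = r \<or> t \<in> principal_right r"
proof (rule ccontr)
  assume neg: "\<not> ?thesis"
  \<comment> \<open>On spanning elements, \<open>P\<close> kills every term with
    \<open>b \<noteq> None\<close>. The remaining terms contain \<open>v w\<close> with
    \<open>w = r\<close> or \<open>w\<close> in \<open>rS\<close>, hence
    \<open>w \<noteq> t\<close>, and vanish by \<open>\<Phi>_off_diagonal\<close>.\<close>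
  define W where "W = {x. \<Phi> (v r * x * P * star (v t)) = 0}"
  have "star (v r) * v t \<in> W"
  proof (rule in_closed_csubspace)
    show "csubspace W"
      by (auto simp: csubspace_def W_def \<Phi>_add \<Phi>_scaleC distrib_left distrib_right
          scaleC_mult_left scaleC_mult_right)
    show "closed W"
      unfolding W_def by (intro closed_Collect_eq continuous_on_\<Phi> continuous_intros)
    fix a b :: "'s option" assume ab: "a \<in> unitisation" "b \<in> unitisation"
    show "V a * star (V b) \<in> W"
    proof (cases b)
      case None
      define w where "w = (case a of None \<Rightarrow> r | Some s \<Rightarrow> r * s)"
      have w: "v r * V a = v w"
        by (cases a) (auto simp: w_def unitise_def v_mult)
      have "w \<noteq> t"
        using neg by (cases a) (auto simp: w_def mem_principal_right)
      then have "\<Phi> (v r * V a * P * star (v t)) = 0"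
        using \<Phi>_off_diagonal[OF no_id _ P(1)] by (simp add: w)
      then show ?thesis using None by (simp add: W_def unitise_def mult.assoc)
    next
      case (Some s)
      then show ?thesis by (simp add: W_def unitise_def mult.assoc) (simp add: kill flip: mult.assoc)
    qed
  qed
  \<comment> \<open>Membership of \<open>star (v r) * v t\<close> in \<open>W\<close> thus says that
    the positive element \<open>v t * P * star (v t)\<close> has zero expectation, so faithfulness
    forces \<open>P = 0\<close>.\<close>
  moreover have "v r * star (v r) * v t = v t"
  proof -
    have c: "principal_right p \<in> constructible" for p :: 's
      by (simp add: principal_right_def constructible.intros)
    have "v r * star (v r) * v t = (v r * star (v r)) * (v t * star (v t)) * v t"
      by (simp add: v_isometry mult.assoc)
    also have "\<dots> = v t * star (v t) * v t"
      using sub by (simp add: v_range e_Int c Int_absorb1)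
    finally show ?thesis by (simp add: v_isometry mult.assoc)
  qed
  ultimately have "\<Phi> (v t * P * star (v t)) = 0" by (simp add: W_def mult.assoc[symmetric])
  moreover have "v t * P * star (v t) = star (P * star (v t)) * (P * star (v t))"
    using P(2) by (simp add: is_projection_def star_mult star_star) (metis mult.assoc)
  ultimately have "v t * P * star (v t) = 0"
    using faithful unfolding faithful_on_positives_def cpositive_def by metis
  then have "star (v t) * (v t * P * star (v t)) * v t = 0" by simp
  then have "P = 0" by (simp add: mult.assoc v_isometry v_cancel)
  with P(3) show False ..
qed

text \<open>With an identity, the generator of the covered ideal lies in one covering ideal, which
  then contains the whole ideal and makes the product zero. Without one, cancelling \<open>r\<close>
  from the intersections yields finitely many principal ideals covering \<open>S\<close>, contrary
  to \<open>no_finite_principal_cover\<close>.\<close>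

lemma independence:
  assumes nz: "e (principal_unitised r) * gap (map principal_unitised qs) \<noteq> 0"
  shows "\<not> principal_unitised r \<subseteq> \<Union>(principal_unitised ` set qs)"
proof
  assume cover: "principal_unitised r \<subseteq> \<Union>(principal_unitised ` set qs)"
  let ?Q = "gap (map principal_unitised qs)"
  have not_sub: "\<not> principal_unitised r \<subseteq> principal_unitised q" if "q \<in> set qs" for q
    using gap_absorb[of "map principal_unitised qs" "principal_unitised r" "principal_unitised q"]
      nz that by (auto simp: image_subset_iff)
  have no_id: "\<nexists>u::'s. is_identity u"
  proof
    assume "\<exists>u::'s. is_identity u"
    then obtain u :: 's where u: "is_identity u" by blast
    define g where "g = (case r of None \<Rightarrow> u | Some s \<Rightarrow> s)"
    have "s * u = s" "u * s = s" for s using u by (auto simp: is_identity_def)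
    then have g: "principal_unitised r = principal_right g" "g \<in> principal_right g"
      by (cases r; auto simp: g_def mem_principal_right; metis)+
    then obtain q where "q \<in> set qs" "g \<in> principal_unitised q" using cover by auto
    then show False using not_sub principal_unitised_mono g by metis
  qed
  have ex: "\<exists>y. \<forall>s. unitised_mult r s \<in> principal_unitised q \<longrightarrow> s \<in> principal_right y"
    if q: "q \<in> set qs" for q
  proof (cases r)
    case None
    then show ?thesis
      using not_sub[OF q] by (cases q) (auto simp: unitised_mult_def)
  next
    case (Some s)
    define Xs where "Xs = map (\<lambda>q. lpreimage s (principal_unitised q)) qs"
    have Xs: "set Xs \<subseteq> constructible" by (auto simp: Xs_def intro: constructible.intros)
    have Qv: "?Q * v s = v s * gap Xs"
      by (subst gap_mult_v) (auto simp: Xs_def o_def)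
    have "e (principal_right s) * ?Q = ?Q * e (principal_right s)"
      by (rule commute_gap)
        (auto simp: e_commute simp del: principal_unitised_simps(2) simp flip: principal_unitised_simps(2))
    then have "gap Xs \<noteq> 0"
      using nz Some by (auto simp: v_range[symmetric] Qv simp flip: mult.assoc)
    \<comment> \<open>The cover puts \<open>s * p\<close> into some covering ideal, so
      \<open>pS\<close> lies in its preimage under \<open>s\<close>. Hence \<open>gap Xs\<close> is
      a nonzero projection as required by \<open>principal_right_subset_cases\<close>.\<close>
    have kill: "star (v p) * gap Xs = 0" for p
    proof -
      have "s * p \<in> principal_unitised r" using Some by simp
      then obtain q where q: "q \<in> set qs" "s * p \<in> principal_unitised q"
        using cover by auto
      have "s * p * t \<in> principal_unitised q" for t
        using principal_unitised_mono[OF q(2)] mult_mem_principal_right[of "s * p" t] by blast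
      then have "principal_right p \<subseteq> lpreimage s (principal_unitised q)"
        by (auto simp: lpreimage_def mem_principal_right[of _ p] simp flip: mult.assoc)
      then have "e (principal_right p) * gap Xs = 0"
        using q(1) by (intro gap_absorb[OF Xs]) (auto simp: Xs_def principal_right_def intro: constructible.intros)
      then have "star (v p) * (v p * star (v p) * gap Xs) = 0" by (simp add: v_range)
      then show ?thesis by (simp add: mult.assoc v_cancel)
    qed
    show ?thesis
      using principal_unitised_Int[OF LCM, of r q]
    proof (elim disjE exE)
      assume "principal_unitised r \<inter> principal_unitised q = {}"
      then show ?thesis
        using Some mult_mem_principal_right by (fastforce simp: unitised_mult_def disjoint_iff)
    next
      fix t assume t: "principal_unitised r \<inter> principal_unitised q = principal_unitised t"
      obtain t' where t': "t = Some t'"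
        using t not_sub[OF q] by (cases t) auto
      have "t' = s \<or> t' \<in> principal_right s"
        using principal_right_subset_cases[OF no_id gap_in_diagonal[OF Xs] gap_projection[OF Xs]
            \<open>gap Xs \<noteq> 0\<close> kill, of t' s] t t' Some by auto
      moreover have "t' \<noteq> s" using t t' Some not_sub[OF q] by auto
      ultimately obtain y where y: "t' = s * y" by (auto simp: mem_principal_right)
      have "x \<in> principal_right y" if "s * x \<in> principal_unitised q" for x
      proof -
        have "s * x \<in> principal_right (s * y)" using t t' y that Some by auto
        then show ?thesis
          using left_cancel by (auto simp: mem_principal_right left_cancellative_def mult.assoc)
      qed
      then show ?thesis using Some by (auto simp: unitised_mult_def)
    qed
  qed
  then obtain g where g: "\<And>q s. q \<in> set qs \<Longrightarrow> unitised_mult r s \<in> principal_unitised q \<Longrightarrow>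
      s \<in> principal_right (g q)" by metis
  have "(\<Union>y\<in>g ` set qs. principal_right y) = UNIV"
  proof -
    have "\<exists>q\<in>set qs. x \<in> principal_right (g q)" for x
    proof -
      have "unitised_mult r x \<in> principal_unitised r" by (auto simp: mem_principal_unitised)
      then obtain q where "q \<in> set qs" "unitised_mult r x \<in> principal_unitised q" using cover by auto
      then show ?thesis using g by blast
    qed
    then show ?thesis by auto
  qed
  then show False
    using no_finite_principal_cover[OF left_cancel right_cancel no_id, of "g ` set qs"] by simp
qed

text \<open>The scalar \<open>c\<close> is the value of the diagonal part of the approximation on an
  atom carrying its norm. Compressing the approximation by a suitable \<open>v (s * z)\<close> gives
  exactly \<open>c\<close>. The margins suffice: \<open>c\<close> has modulus at least 7/8 of
  \<open>\<delta>\<close>, and the error is below 1/8 of \<open>\<delta>\<close>.\<close>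

lemma compression:
  assumes D3: "cond_D3 TYPE('s)"
    and sep: "\<And>t t' :: 's. t \<noteq> t' \<Longrightarrow>
      \<exists>z. principal_right (t * z) \<inter> principal_right (t' * z) = {}"
    and "b \<noteq> 0"
  shows "\<exists>s c. c \<noteq> 0 \<and> norm (star (v s) * (star b * b) * v s - c *\<^sub>C 1) \<le> cmod c / 4"
proof -
  define a where "a = star b * b"
  define \<delta> where "\<delta> = norm (\<Phi> a)"
  have "a \<noteq> 0" using \<open>b \<noteq> 0\<close> by (simp add: a_def star_mult_self_eq_0)
  moreover have "cpositive a" by (auto simp: a_def cpositive_def)
  ultimately have "\<Phi> a \<noteq> 0" using faithful unfolding faithful_on_positives_def by blast
  then have \<delta>: "\<delta> > 0" by (simp add: \<delta>_def)
  then obtain xs where xs: "set xs \<subseteq> UNIV \<times> unitisation \<times> unitisation"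
    and ax: "norm (a - combination xs) < \<delta> / 8"
    using combination_approx[of "\<delta> / 8" a] by auto
  define ps where "ps = remdups (map (\<lambda>(l, p, q). p) xs @ map (\<lambda>(l, p, q). q) xs)"
  have ps: "p \<in> set ps" "q \<in> set ps" if "(l, p, q) \<in> set xs" for l p q
    using that by (force simp: ps_def)+
  have ps_unit: "set ps \<subseteq> unitisation" using xs by (auto simp: ps_def)
  define y where "y = \<Phi> (combination xs)"
  have y: "y = sum_list (map (\<lambda>(l, p, q). if p = q then l *\<^sub>C e (principal_unitised p) else 0) xs)"
    using xs unfolding y_def combination_def
    by (induction xs) (auto simp: \<Phi>_add \<Phi>_scaleC \<Phi>_unitise V_range)
  have comm: "y * e (principal_unitised p) = e (principal_unitised p) * y" for p
    unfolding y
    by (induction xs) (auto simp: algebra_simps scaleC_mult_left scaleC_mult_right e_commute)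
  have "norm (\<Phi> a - y) < \<delta> / 8"
    unfolding y_def \<Phi>_diff[symmetric] using norm_\<Phi>_le ax by (rule le_less_trans)
  moreover have "norm (\<Phi> a) \<le> norm (\<Phi> a - y) + norm y"
    using norm_triangle_ineq[of "\<Phi> a - y" y] by simp
  ultimately have ny: "norm y \<ge> 7 * \<delta> / 8" by (simp add: \<delta>_def)
  have "distinct ps" by (simp add: ps_def)
  then obtain A where A: "norm y \<le> norm (atom A ps * y)"
    using norm_atom comm by blast
  define c where "c = sum_list (map (\<lambda>(l, p, q). if p = q \<and> p \<in> A then l else 0) xs)"
  have "atom A ps * sum_list (map (\<lambda>(l, p, q). if p = q then l *\<^sub>C e (principal_unitised p) else 0) zs) =
      sum_list (map (\<lambda>(l, p, q). if p = q \<and> p \<in> A then l else 0) zs) *\<^sub>C atom A ps"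
    if "set zs \<subseteq> set xs" for zs
    using that
    by (induction zs)
      (auto simp: algebra_simps scaleC_mult_left scaleC_mult_right scaleC_add_left atom_absorb ps)
  then have atom_y: "atom A ps * y = c *\<^sub>C atom A ps" by (simp add: y c_def)
  have "norm (c *\<^sub>C atom A ps) \<le> cmod c * 1"
    unfolding norm_scaleC by (intro mult_left_mono norm_projection_le atom_projection) auto
  then have c: "cmod c \<ge> 7 * \<delta> / 8" using A ny atom_y by simp
  have "atom A ps \<noteq> 0" using A ny \<delta> by auto
  define F where "F = filter (\<lambda>p. p \<notin> A) ps"
  have "meet (filter (\<lambda>p. p \<in> A) ps) * gap (map principal_unitised F) \<noteq> 0"
    using \<open>atom A ps \<noteq> 0\<close> by (simp add: atom_split F_def)
  then obtain r where r: "e (principal_unitised r) * gap (map principal_unitised F) \<noteq> 0"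
    "\<And>p. p \<in> set ps \<Longrightarrow> p \<in> A \<Longrightarrow> principal_unitised r \<subseteq> principal_unitised p"
    using meet_cases[of "filter (\<lambda>p. p \<in> A) ps"] by auto
  then obtain s where s: "s \<in> principal_unitised r"
    "\<And>q. q \<in> set ps \<Longrightarrow> q \<notin> A \<Longrightarrow> principal_right s \<inter> principal_unitised q = {}"
    using cond_D3_unitised[OF left_cancel D3 _ independence[OF r(1)]] by (auto simp: F_def)
  have "\<exists>t. s = unitised_mult p t" if "p \<in> set ps \<inter> A" for p
    using r(2)[of p] s(1) that by (auto simp: mem_principal_unitised[symmetric])
  then obtain t where t: "\<And>p. p \<in> set ps \<inter> A \<Longrightarrow> s = unitised_mult p (t p)" by metis
  \<comment> \<open>These pairs of cofactors of \<open>s\<close> come from the off-diagonal terms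
    that survive on \<open>s\<close>; a common \<open>z\<close> making their translates disjoint
    kills all these terms at once.\<close>
  define T where "T = {(t p, t q) | p q. p \<in> set ps \<inter> A \<and> q \<in> set ps \<inter> A \<and> p \<noteq> q}"
  have "T \<subseteq> (\<lambda>(p, q). (t p, t q)) ` (set ps \<times> set ps)" by (auto simp: T_def)
  then have "finite T" by (rule finite_subset) auto
  moreover have "t p \<noteq> t q" if "p \<in> set ps \<inter> A" "q \<in> set ps \<inter> A" "p \<noteq> q" for p q
    using unitised_mult_right_cancel[OF left_cancel right_cancel, of p q "t p"] t that ps_unit
    by (metis IntD1 subsetD)
  then have "t' \<noteq> t''" if "(t', t'') \<in> T" for t' t'' using that by (auto simp: T_def)
  ultimately obtain z where z: "\<forall>(t', t'')\<in>T. principal_right (t' * z) \<inter> principal_right (t'' * z) = {}"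
    using ex_disjoint_translates_finite[OF right_cancel sep] by metis
  have in_A: "star (v (s * z)) * V p = star (v (t p * z))" if "p \<in> set ps \<inter> A" for p
  proof -
    have "v (s * z) = V p * v (t p * z)"
      using t[OF that] by (cases p) (auto simp: unitised_mult_def unitise_def v_mult mult.assoc)
    then show ?thesis by (simp add: star_mult V_isometry mult.assoc)
  qed
  have not_in_A: "star (v (s * z)) * V p = 0" if "p \<in> set ps" "p \<notin> A" for p
    using star_V_mult_V_disjoint[of "Some (s * z)" p] s(2)[OF that]
      principal_right_mono[OF mult_mem_principal_right[of s z]]
    by (auto simp: unitise_def)
  \<comment> \<open>Indices outside \<open>A\<close> vanish because \<open>sS\<close> avoids their
    ideals. For two distinct indices in \<open>A\<close> the isometries of the cofactors times
    \<open>z\<close> have orthogonal ranges.\<close>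
  have term_value: "star (v (s * z)) * (V p * star (V q)) * v (s * z) = (if p = q \<and> p \<in> A then 1 else 0)"
    if pq: "p \<in> set ps" "q \<in> set ps" for p q
  proof -
    have "star (v (s * z)) * (V p * star (V q)) * v (s * z) =
        (star (v (s * z)) * V p) * star (star (v (s * z)) * V q)"
      by (simp add: star_mult star_star mult.assoc)
    also have "\<dots> = (if p = q \<and> p \<in> A then 1 else 0)"
    proof (cases "p \<in> A \<and> q \<in> A")
      case True
      show ?thesis
      proof (cases "p = q")
        case True
        with \<open>p \<in> A \<and> q \<in> A\<close> show ?thesis using pq by (simp add: in_A star_star v_isometry)
      next
        case False
        then have "(t p, t q) \<in> T" using True pq by (auto simp: T_def)
        then have "principal_right (t p * z) \<inter> principal_right (t q * z) = {}" using z by auto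
        then have "star (v (t p * z)) * v (t q * z) = 0"
          using star_V_mult_V_disjoint[of "Some (t p * z)" "Some (t q * z)"] by (simp add: unitise_def)
        then show ?thesis using True False pq by (simp add: in_A star_star)
      qed
    next
      case False
      then show ?thesis using pq not_in_A by (metis mult_zero_left mult_zero_right star_zero)
    qed
    finally show ?thesis .
  qed
  have "star (v (s * z)) * combination zs * v (s * z) =
      sum_list (map (\<lambda>(l, p, q). if p = q \<and> p \<in> A then l else 0) zs) *\<^sub>C 1" if "set zs \<subseteq> set xs" for zs
    using that unfolding combination_def
    by (induction zs)
      (auto simp: distrib_left distrib_right scaleC_mult_left scaleC_mult_right scaleC_add_left term_value ps)
  then have comb: "star (v (s * z)) * combination xs * v (s * z) = c *\<^sub>C 1" by (simp add: c_def)
  have nv: "norm (v (s * z)) = 1" by (rule norm_isometry) (rule v_isometry)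
  have "star (v (s * z)) * a * v (s * z) - c *\<^sub>C 1 = star (v (s * z)) * (a - combination xs) * v (s * z)"
    by (simp add: algebra_simps flip: comb)
  also have "norm \<dots> \<le> norm (star (v (s * z))) * norm (a - combination xs) * norm (v (s * z))"
    by (intro order_trans[OF norm_mult_ineq] mult_right_mono norm_mult_ineq norm_ge_zero)
  also have "\<dots> \<le> cmod c / 4" using ax c nv \<delta> by simp
  finally have "norm (star (v (s * z)) * a * v (s * z) - c *\<^sub>C 1) \<le> cmod c / 4" .
  moreover have "c \<noteq> 0" using c \<delta> by auto
  ultimately show ?thesis unfolding a_def by blast
qed

end

section \<open>Simplicity and pure infiniteness\<close>

theorem theorem5p3:
  fixes v :: "'s::semigroup_mult \<Rightarrow> 'a::unital_cstar"
    and e :: "'s set \<Rightarrow> 'a"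
  assumes standing: "invertibles = ({} :: 's set) \<longrightarrow>
      (\<forall>a b :: 's. principal_right a = principal_right b \<longrightarrow> a = b)"
    and cancellative: "left_cancellative TYPE('s)" "right_cancellative TYPE('s)"
    and right_LCM: "right_LCM TYPE('s)"
    and C_star_S: "semigroup_cstar v e"
    and Phi_D: "Phi_D_faithful_expectation v e"
    and D3: "cond_D3 TYPE('s)"
    and cases:
      "(finite (invertibles :: 's set) \<and> card (invertibles :: 's set) \<le> 1) \<or>
       (\<not> (finite (invertibles :: 's set) \<and> card (invertibles :: 's set) \<le> 1) \<and>
          cond_D2 TYPE('s)) \<or>
       (\<not> (finite (invertibles :: 's set) \<and> card (invertibles :: 's set) \<le> 1) \<and>
          cond_D1 TYPE('s) \<and> strongly_effective TYPE('s))"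
  shows "simple_cstar TYPE('a) \<and> ((\<exists>a b :: 's. a \<noteq> b) \<longrightarrow> purely_infinite TYPE('a))"
proof -
  obtain \<Phi> where \<Phi>: "conditional_expectation (diagonal e) \<Phi>" "faithful_on_positives \<Phi>"
    "\<forall>p \<in> unitisation. \<forall>q \<in> unitisation.
      \<Phi> (unitise v p * star (unitise v q)) =
        (if p = q then unitise v p * star (unitise v p) else 0)"
    using Phi_D unfolding Phi_D_faithful_expectation_def by blast
  interpret faithful_expectation v e \<Phi>
    using cancellative right_LCM C_star_S Phi_D \<Phi>
    by unfold_locales (auto simp: semigroup_cstar_def Phi_D_faithful_expectation_def)
  have sep: "\<exists>z. principal_right (t * z) \<inter> principal_right (t' * z) = {}" if "t \<noteq> t'" for t t' :: 's
    by (rule ex_disjoint_translates[OF standing cancellative D3 cases that])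
  \<comment> \<open>Every nonzero \<open>b\<close> can be compressed to an element near a positive
    scalar, which an inverse square root normalises to 1. For \<open>b\<close> in an ideal this puts
    1 into the ideal.\<close>
  have key: "\<exists>s z \<rho>. \<rho> > 0 \<and> star z = z \<and>
      z * ((1 / \<rho>) *\<^sub>R (star (b * v s) * (b * v s))) * z = 1" if "b \<noteq> 0" for b
  proof -
    from compression[OF D3 sep that]
    obtain s c where "c \<noteq> 0" "norm (star (v s) * (star b * b) * v s - c *\<^sub>C 1) \<le> cmod c / 4"
      by blast
    then have "norm (star (b * v s) * (b * v s) - c *\<^sub>C 1) \<le> cmod c / 4"
      by (simp add: star_mult mult.assoc)
    then obtain \<rho> where \<rho>: "\<rho> > 0" "norm ((1 / \<rho>) *\<^sub>R (star (b * v s) * (b * v s)) - 1) \<le> 3/4"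
      using star_mult_self_near_scalar \<open>c \<noteq> 0\<close> by blast
    moreover have "star ((1 / \<rho>) *\<^sub>R (star (b * v s) * (b * v s))) = (1 / \<rho>) *\<^sub>R (star (b * v s) * (b * v s))"
      by (simp add: star_scaleR star_mult star_star)
    ultimately show ?thesis using self_adjoint_inverse_sqrt by metis
  qed
  have "simple_cstar TYPE('a)"
    unfolding simple_cstar_def
  proof (intro allI impI, elim conjE)
    fix I :: "'a set"
    assume sub: "csubspace I" and ideal: "\<forall>a. \<forall>x\<in>I. a * x \<in> I \<and> x * a \<in> I"
    show "I = {0} \<or> I = UNIV"
    proof (cases "I = {0}")
      case False
      then obtain b where b: "b \<in> I" "b \<noteq> 0" using sub by (auto simp: csubspace_def)
      then obtain s z \<rho> where eq: "z * ((1 / \<rho>) *\<^sub>R (star (b * v s) * (b * v s))) * z = 1"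
        using key by blast
      have "star (b * v s) * (b * v s) \<in> I" using b(1) ideal by blast
      then have "(1 / \<rho>) *\<^sub>R (star (b * v s) * (b * v s)) \<in> I"
        using sub unfolding csubspace_def by (metis scaleC_of_real)
      then have "1 \<in> I" using ideal eq by metis
      then have "x \<in> I" for x using ideal mult.right_neutral by metis
      then show ?thesis by blast
    qed simp
  qed
  moreover have "purely_infinite TYPE('a)" if ne: "\<exists>a b :: 's. a \<noteq> b"
    unfolding purely_infinite_def
  proof (intro allI impI, elim conjE)
    fix B :: "'a set"
    assume B: "hereditary_subalgebra B" "B \<noteq> {0}"
    then have "0 \<in> B"
      by (auto simp: hereditary_subalgebra_def cstar_subalgebra_def csubspace_def)
    then obtain b where b: "b \<in> B" "b \<noteq> 0" using B(2) by auto
    obtain s z \<rho> where z: "\<rho> > 0" "star z = z"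
      "z * ((1 / \<rho>) *\<^sub>R (star (b * v s) * (b * v s))) * z = 1"
      using key[OF b(2)] by blast
    \<comment> \<open>This choice makes \<open>b * y\<close> an isometry.\<close>
    define y where "y = (1 / sqrt \<rho>) *\<^sub>R (v s * z)"
    have b_y: "b * y = (1 / sqrt \<rho>) *\<^sub>R (b * v s * z)" by (simp add: y_def mult.assoc)
    have "star (b * y) * (b * y) = z * ((1 / \<rho>) *\<^sub>R (star (b * v s) * (b * v s))) * z"
      using z(1) unfolding b_y by (simp add: star_scaleR star_mult z(2) mult.assoc)
    then have iso: "star (b * y) * (b * y) = 1" by (simp only: z(3))
    \<comment> \<open>Disjoint ideals provide a nonunitary isometry: if
      \<open>v t * star (v t) = 1\<close>, then \<open>star (v t) * v t' = 0\<close> would give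
      \<open>v t' = 0\<close>.\<close>
    obtain t t' :: 's where "principal_right t \<inter> principal_right t' = {}"
      using ne sep by blast
    then have "star (v t) * v t' = 0"
      using star_V_mult_V_disjoint[of "Some t" "Some t'"] by (simp add: unitise_def)
    then have "v t * star (v t) \<noteq> 1"
      using v_isometry[of t'] by (metis mult.assoc mult_1 mult_zero_right zero_neq_one)
    then have "infinite_projection ((b * y) * star (b * y))"
      using iso v_isometry by (intro infinite_projection_isometry)
    then show "\<exists>p\<in>B. infinite_projection p"
      using hereditary_conjugate[OF B(1) b(1)] by blast
  qed
  ultimately show ?thesis by blast
qed

end
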